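(* Let $\Gamma$ be a countably infinite discrete group. Then every conjugacy class in $\mathrm{Rep}(\Gamma,\mathbb{G})$ is meager.
   Context: $\mathbb{G}$ denotes the (real) Gurarij space, i.e., the unique up to linear isometry separable Banach space such that for every $\varepsilon>0$, all finite-dimensional Banach spaces $E\subseteq F$ and every linear isometric embedding $f:E\to\mathbb{G}$ there is a linear embedding $\bar f:F\to\mathbb{G}$ extending $f$ with $(1+\varepsilon)^{-1}\|x\|\leq\|\bar f(x)\|\leq(1+\varepsilon)\|x\|$ for all $x\in F$. $\mathrm{LIso}(\mathbb{G})$ is the Polish group of surjective linear isometries of $\mathbb{G}$ with the topology of pointwise convergence (strong operator topology), and $\mathrm{Rep}(\Gamma,\mathbb{G})$ is the Polish space of all homomorphisms $\Gamma\to\mathrm{LIso}(\mathbb{G})$, a closed subspace of $\mathrm{LIso}(\mathbb{G})^\Gamma$. $\mathrm{LIso}(\mathbb{G})$ acts on it by conjugation, $(g.\pi)(\gamma)=g\pi(\gamma)g^{-1}$, and conjugacy classes are the orbits of this action. *)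

theory Defs
  imports "HOL-Analysis.Analysis" "HOL-Analysis.Finite_Function_Topology" "HOL-Algebra.Group_Action"
begin

definition norm_on :: "'v::real_vector set \<Rightarrow> ('v \<Rightarrow> real) \<Rightarrow> bool" where
  "norm_on V N \<longleftrightarrow>
     (\<forall>x\<in>V. 0 \<le> N x \<and> (N x = 0 \<longleftrightarrow> x = 0)) \<and>
     (\<forall>x\<in>V. \<forall>c. N (c *\<^sub>R x) = \<bar>c\<bar> * N x) \<and>
     (\<forall>x\<in>V. \<forall>y\<in>V. N (x + y) \<le> N x + N y)"

definition finite_dim_normed :: "'v::real_vector set \<Rightarrow> ('v \<Rightarrow> real) \<Rightarrow> bool" where
  "finite_dim_normed V N \<longleftrightarrow> subspace V \<and> (\<exists>B. finite B \<and> V = span B) \<and> norm_on V N"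

definition linear_map_on :: "'v::real_vector set \<Rightarrow> ('v \<Rightarrow> 'w::real_vector) \<Rightarrow> bool" where
  "linear_map_on V f \<longleftrightarrow>
     (\<forall>x\<in>V. \<forall>y\<in>V. f (x + y) = f x + f y) \<and> (\<forall>x\<in>V. \<forall>c. f (c *\<^sub>R x) = c *\<^sub>R f x)"

text \<open>
  The finite-dimensional Banach spaces range over the finite-dimensional subspaces \<open>F\<close> of the
  space \<open>nat \<Rightarrow>\<^sub>0 real\<close> of finitely supported sequences, each with an arbitrary norm \<open>N\<close> on \<open>F\<close>
  (unrelated to the type-class norm of \<open>nat \<Rightarrow>\<^sub>0 real\<close>).  Up to linear isometry these are all
  finite-dimensional Banach spaces, by \<open>finite_dim_embeds\<close> below; completeness is automatic
  in finite dimension.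
\<close>

definition gurarij_space :: "'g::banach itself \<Rightarrow> bool" where
  "gurarij_space _ \<longleftrightarrow>
     separable_space (euclidean :: 'g topology) \<and>
     (\<forall>\<epsilon>>0. \<forall>(E :: (nat \<Rightarrow>\<^sub>0 real) set) F N (f :: (nat \<Rightarrow>\<^sub>0 real) \<Rightarrow> 'g).
        finite_dim_normed F N \<and> subspace E \<and> E \<subseteq> F \<and>
        linear_map_on E f \<and> (\<forall>x\<in>E. norm (f x) = N x) \<longrightarrow>
        (\<exists>f' :: (nat \<Rightarrow>\<^sub>0 real) \<Rightarrow> 'g.
           linear_map_on F f' \<and> (\<forall>x\<in>E. f' x = f x) \<and>
           (\<forall>x\<in>F. inverse (1 + \<epsilon>) * N x \<le> norm (f' x) \<and> norm (f' x) \<le> (1 + \<epsilon>) * N x)))"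

lemma finite_dim_embeds:
  fixes B :: "'v::real_vector set"
  assumes "finite B"
  shows "\<exists>h :: 'v \<Rightarrow> (nat \<Rightarrow>\<^sub>0 real). linear h \<and> inj_on h (span B)"
proof -
  obtain B' where B': "B' \<subseteq> B" "independent B'" "B \<subseteq> span B'"
    using maximal_independent_subset[of B] by blast
  have "finite B'" using B' assms finite_subset by blast
  then obtain e :: "'v \<Rightarrow> nat" where e: "inj_on e B'"
    using finite_imp_inj_to_nat_seg by blast
  let ?u = "\<lambda>b. Poly_Mapping.single (e b) (1::real)"
  obtain h where h: "linear h" "\<And>b. b \<in> B' \<Longrightarrow> h b = ?u b"
    using linear_independent_extend[OF B'(2), of ?u] by blast
  have "inj_on h (span B')"
    unfolding linear_inj_on_iff_eq_0[OF h(1) subspace_span]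
  proof (intro ballI impI)
    fix x assume x: "x \<in> span B'" and hx: "h x = 0"
    obtain c where c: "x = (\<Sum>b\<in>B'. c b *\<^sub>R b)"
      using x span_finite[OF \<open>finite B'\<close>] by auto
    have "c b = 0" if b: "b \<in> B'" for b
    proof -
      have "h x = (\<Sum>b\<in>B'. c b *\<^sub>R ?u b)"
        using h by (simp add: c linear_sum linear_scale)
      then have "0 = Poly_Mapping.lookup (\<Sum>a\<in>B'. c a *\<^sub>R ?u a) (e b)"
        using hx by simp
      also have "\<dots> = (\<Sum>a\<in>B'. c a * Poly_Mapping.lookup (?u a) (e b))"
        by (simp add: lookup_sum scaleR_poly_mapping_def Abs_poly_mapping_inverse
              when_def lookup_single)
      also have "\<dots> = (\<Sum>a\<in>B'. if a = b then c a else 0)"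
        using e b by (intro sum.cong) (auto simp: lookup_single when_def inj_on_def)
      also have "\<dots> = c b" using b \<open>finite B'\<close> by simp
      finally show ?thesis by simp
    qed
    then show "x = 0" by (simp add: c)
  qed
  moreover have "span B \<subseteq> span B'" using B'(3) span_minimal subspace_span by blast
  ultimately show ?thesis using h(1) inj_on_subset by blast
qed

definition nowhere_dense_in :: "'a topology \<Rightarrow> 'a set \<Rightarrow> bool" where
  "nowhere_dense_in X S \<longleftrightarrow> S \<subseteq> topspace X \<and> X interior_of (X closure_of S) = {}"

definition meager_in :: "'a topology \<Rightarrow> 'a set \<Rightarrow> bool" where
  "meager_in X S \<longleftrightarrow> (\<exists>\<A>. countable \<A> \<and> (\<forall>A\<in>\<A>. nowhere_dense_in X A) \<and> S = \<Union>\<A>)"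

definition LIso :: "('g::real_normed_vector \<Rightarrow> 'g) monoid" where
  "LIso = \<lparr>carrier = {T. linear T \<and> surj T \<and> (\<forall>x. norm (T x) = norm x)},
           mult = (\<circ>), one = id\<rparr>"

definition LIso_topology :: "('g::real_normed_vector \<Rightarrow> 'g) topology" where
  "LIso_topology = subtopology (product_topology (\<lambda>_. euclidean) UNIV) (carrier LIso)"

lemma topspace_LIso_topology [simp]: "topspace LIso_topology = carrier LIso"
  by (simp add: LIso_topology_def)

lemma group_LIso: "group (LIso :: ('g::real_normed_vector \<Rightarrow> 'g) monoid)"
proof (rule groupI)
  fix T :: "'g \<Rightarrow> 'g" assume "T \<in> carrier LIso"
  then have T: "linear T" "surj T" "\<And>x. norm (T x) = norm x" by (auto simp: LIso_def)
  let ?S = "inv_into UNIV T"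
  have "inj T"
    unfolding linear_injective_0[OF T(1)] using T(3) by (metis norm_eq_zero)
  then have "surj ?S" "?S \<circ> T = id" by (auto simp: inj_imp_surj_inv)
  moreover have TS: "T (?S x) = x" for x by (simp add: T(2) surj_f_inv_f)
  have "linear ?S"
    by (intro linearI; rule injD[OF \<open>inj T\<close>]) (simp_all add: TS linear_add linear_scale T(1))
  moreover have "norm (?S x) = norm x" for x
    by (metis T(3) TS)
  ultimately show "\<exists>S\<in>carrier LIso. S \<otimes>\<^bsub>LIso\<^esub> T = \<one>\<^bsub>LIso\<^esub>"
    by (intro bexI[of _ ?S]) (auto simp: LIso_def)
next
  fix S T :: "'g \<Rightarrow> 'g" assume "S \<in> carrier LIso" "T \<in> carrier LIso"
  then show "S \<otimes>\<^bsub>LIso\<^esub> T \<in> carrier LIso"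
    using comp_surj[of T S] linear_compose[of T S] by (simp add: LIso_def)
qed (simp_all add: LIso_def linear_id[unfolded id_def] id_def comp_assoc fun_eq_iff)

text \<open>
  Homomorphisms are taken extensional (undefined outside the carrier), as are the points of
  \<open>product_topology\<close>.
\<close>

definition Rep :: "('a, 'b) monoid_scheme \<Rightarrow> ('a \<Rightarrow> 'g::real_normed_vector \<Rightarrow> 'g) set" where
  "Rep \<Gamma> = hom \<Gamma> LIso \<inter> extensional (carrier \<Gamma>)"

definition Rep_topology ::
    "('a, 'b) monoid_scheme \<Rightarrow> ('a \<Rightarrow> 'g::real_normed_vector \<Rightarrow> 'g) topology" where
  "Rep_topology \<Gamma> = subtopology (product_topology (\<lambda>_. LIso_topology) (carrier \<Gamma>)) (Rep \<Gamma>)"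

lemma topspace_Rep_topology [simp]: "topspace (Rep_topology \<Gamma>) = Rep \<Gamma>"
  by (auto simp: Rep_topology_def Rep_def hom_def PiE_def)

definition conj_action ::
    "('a, 'b) monoid_scheme \<Rightarrow> ('g::real_normed_vector \<Rightarrow> 'g) \<Rightarrow>
       ('a \<Rightarrow> 'g \<Rightarrow> 'g) \<Rightarrow> ('a \<Rightarrow> 'g \<Rightarrow> 'g)" where
  "conj_action \<Gamma> g =
     (\<lambda>\<pi>\<in>Rep \<Gamma>. \<lambda>\<gamma>\<in>carrier \<Gamma>. g \<otimes>\<^bsub>LIso\<^esub> \<pi> \<gamma> \<otimes>\<^bsub>LIso\<^esub> inv\<^bsub>LIso\<^esub> g)"

definition conjugacy_classes ::
    "('a, 'b) monoid_scheme \<Rightarrow> ('a \<Rightarrow> 'g::real_normed_vector \<Rightarrow> 'g) set set" where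
  "conjugacy_classes \<Gamma> = orbits LIso (Rep \<Gamma>) (conj_action \<Gamma>)"

lemma conj_action_group_action:
  assumes "group \<Gamma>"
  shows "group_action (LIso :: ('g::real_normed_vector \<Rightarrow> 'g) monoid) (Rep \<Gamma>) (conj_action \<Gamma>)"
proof -
  interpret L: group "LIso :: ('g \<Rightarrow> 'g) monoid" by (rule group_LIso)
  interpret \<Gamma>: group \<Gamma> by fact
  let ?c = "conj_action \<Gamma> :: ('g \<Rightarrow> 'g) \<Rightarrow> _"
  have cl: "?c g \<pi> \<in> Rep \<Gamma>" if "g \<in> carrier LIso" "\<pi> \<in> Rep \<Gamma>" for g \<pi>
  proof -
    have p: "\<pi> x \<in> carrier LIso" if "x \<in> carrier \<Gamma>" for x
      using \<open>\<pi> \<in> Rep \<Gamma>\<close> that by (auto simp: Rep_def hom_def)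
    have "g \<otimes>\<^bsub>LIso\<^esub> (\<pi> x \<otimes>\<^bsub>LIso\<^esub> \<pi> y) \<otimes>\<^bsub>LIso\<^esub> inv\<^bsub>LIso\<^esub> g =
        g \<otimes>\<^bsub>LIso\<^esub> \<pi> x \<otimes>\<^bsub>LIso\<^esub> inv\<^bsub>LIso\<^esub> g \<otimes>\<^bsub>LIso\<^esub> (g \<otimes>\<^bsub>LIso\<^esub> \<pi> y \<otimes>\<^bsub>LIso\<^esub> inv\<^bsub>LIso\<^esub> g)"
      if "x \<in> carrier \<Gamma>" "y \<in> carrier \<Gamma>" for x y
      using that p \<open>g \<in> carrier LIso\<close>
      by (simp add: L.m_assoc L.inv_solve_left L.inv_closed flip: L.m_assoc[of "inv\<^bsub>LIso\<^esub> g" g])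
    then show ?thesis
      using that p by (auto simp: conj_action_def Rep_def hom_def)
  qed
  have mult: "?c (g \<otimes>\<^bsub>LIso\<^esub> h) \<pi> = ?c g (?c h \<pi>)"
    if "g \<in> carrier LIso" "h \<in> carrier LIso" "\<pi> \<in> Rep \<Gamma>" for g h \<pi>
  proof -
    have p: "\<pi> x \<in> carrier LIso" if "x \<in> carrier \<Gamma>" for x
      using \<open>\<pi> \<in> Rep \<Gamma>\<close> that by (auto simp: Rep_def hom_def)
    have "?c g (?c h \<pi>) = (\<lambda>\<gamma>\<in>carrier \<Gamma>. g \<otimes>\<^bsub>LIso\<^esub> ?c h \<pi> \<gamma> \<otimes>\<^bsub>LIso\<^esub> inv\<^bsub>LIso\<^esub> g)"
      using cl[OF that(2,3)] by (simp add: conj_action_def[of _ g])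
    then show ?thesis
      using that p by (auto simp: conj_action_def L.m_assoc L.inv_mult_group intro!: restrict_ext)
  qed
  have one: "?c \<one>\<^bsub>LIso\<^esub> \<pi> = \<pi>" if "\<pi> \<in> Rep \<Gamma>" for \<pi>
  proof
    fix x
    show "?c \<one>\<^bsub>LIso\<^esub> \<pi> x = \<pi> x"
      using that by (cases "x \<in> carrier \<Gamma>") (auto simp: conj_action_def Rep_def hom_def extensional_def Pi_iff)
  qed
  have bij: "?c g \<in> Bij (Rep \<Gamma>)" if g: "g \<in> carrier LIso" for g
  proof -
    have "bij_betw (?c g) (Rep \<Gamma>) (Rep \<Gamma>)"
    proof (rule bij_betw_byWitness[where f' = "?c (inv\<^bsub>LIso\<^esub> g)"])
      show "\<forall>\<pi>\<in>Rep \<Gamma>. ?c (inv\<^bsub>LIso\<^esub> g) (?c g \<pi>) = \<pi>"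
        using g one by (simp flip: mult)
      show "\<forall>\<pi>\<in>Rep \<Gamma>. ?c g (?c (inv\<^bsub>LIso\<^esub> g) \<pi>) = \<pi>"
        using g one by (simp flip: mult)
    qed (use g cl in auto)
    then show ?thesis by (simp add: Bij_def conj_action_def)
  qed
  have "?c (g \<otimes>\<^bsub>LIso\<^esub> h) = compose (Rep \<Gamma>) (?c g) (?c h)"
    if "g \<in> carrier LIso" "h \<in> carrier LIso" for g h
  proof
    fix \<pi> show "?c (g \<otimes>\<^bsub>LIso\<^esub> h) \<pi> = compose (Rep \<Gamma>) (?c g) (?c h) \<pi>"
      using mult[OF that] by (cases "\<pi> \<in> Rep \<Gamma>") (auto simp: compose_def conj_action_def)
  qed
  then have "?c \<in> hom LIso (BijGroup (Rep \<Gamma>))"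
    using bij by (auto simp: hom_def BijGroup_def)
  then show ?thesis
    by (simp add: group_action_def group_hom_def group_hom_axioms_def group_BijGroup L.group_axioms)
qed

end

theory Submission
  imports Defs
begin

text \<open>
  Fix a representation \<open>\<pi>\<close> and look at the displacement \<open>norm (\<pi> \<gamma> x - x)\<close> of a vector \<open>x\<close>, as a
  function of \<open>\<gamma>\<close>.  Conjugating \<open>\<pi>\<close> by \<open>g\<close> and moving \<open>x\<close> to \<open>g x\<close> leaves this function unchanged,
  and it depends on \<open>x\<close> in a Lipschitz way, uniformly in \<open>\<gamma>\<close>.  Hence, if \<open>\<psi>\<close> is the displacement
  function of one nonzero vector for one member of a conjugacy class, every member of the class
  has, at some point \<open>y\<close> of a fixed countable dense set, a displacement function uniformly close
  to \<open>\<psi>\<close>.  So the class is covered by countably many closed sets, one for each \<open>y\<close>, and it is enough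
  that each of them has empty interior (\<open>nowhere_dense_displacement_near\<close>).
  
  Empty interior follows from \<open>Rep_near_with_displacements\<close>: arbitrarily close to any \<open>\<pi>\<close> there
  are representations \<open>\<rho>\<close> and \<open>\<sigma>\<close> and one \<open>h\<close> in the group such that \<open>\<rho> h\<close> moves \<open>y\<close> by almost
  \<open>2 * norm y\<close> and \<open>\<sigma> h\<close> moves \<open>y\<close> by at most about \<open>norm y\<close>; no single value \<open>\<psi> h\<close> is close to both.
  The two representations come from explicit models.  The group acts by right translation on
  bounded functions from the group to the Gurarij space, and \<open>x\<close> is sent to the function
  \<open>g \<mapsto> u g *\<^sub>R \<pi> g x\<close>.  With \<open>u = 1\<close> this is equivariant; with a finitely supported cutoff \<open>u\<close>, equal
  to 1 at the identity and varying slowly in the directions of a given finite set \<open>F\<close>, it is still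
  isometric and almost equivariant for \<open>F\<close>.  As the group is infinite, some \<open>h\<close> moves the support
  of \<open>u\<close> off itself.  Then \<open>h\<close> moves the image of \<open>y\<close> by at most \<open>norm y\<close>; and after subtracting a
  left translate of the function with disjoint support, the displacement becomes \<open>2 * norm y\<close>.
  
  It remains to move a model into the Gurarij space (\<open>Rep_near_model\<close>).  A model and finitely many
  vectors give an invariant seminorm on a free module over the group, together with an almost
  isometric map of a finite-dimensional piece of the module to the Gurarij space.  A
  back-and-forth argument (\<open>realize_invariant_seminorm\<close>) corrects this map to an isometric one with
  dense range.  One direction, \<open>improve_realization\<close>, enlarges the domain and shrinks the error; it
  is where the extension property of the Gurarij space is used.  The other, \<open>adjoin_generator\<close>,
  makes the range dense: a free generator is added to the module and the seminorm is extended so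
  that the generator sits over the finite-dimensional piece as a prescribed vector of the Gurarij
  space does.  The translations of the module then become surjective linear isometries of the
  Gurarij space.
\<close>

section \<open>Finitely supported vectors and seminorms\<close>

definition unit_vec :: "'i \<Rightarrow> ('i \<Rightarrow>\<^sub>0 real)" where
  "unit_vec i = Poly_Mapping.single i 1"

text \<open>
  A linear map out of the free vector space on an index set is the same as a family of images of
  the basis vectors; all maps out of such spaces are given in this form.
\<close>

definition lin :: "('i \<Rightarrow> 'w::real_vector) \<Rightarrow> ('i \<Rightarrow>\<^sub>0 real) \<Rightarrow> 'w" where
  "lin a v = (\<Sum>i\<in>Poly_Mapping.keys v. Poly_Mapping.lookup v i *\<^sub>R a i)"

definition supported :: "'i set \<Rightarrow> ('i \<Rightarrow>\<^sub>0 real) set" where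
  "supported A = {v. Poly_Mapping.keys v \<subseteq> A}"

lemma lookup_scaleR [simp]:
  "Poly_Mapping.lookup (c *\<^sub>R v) i = c *\<^sub>R Poly_Mapping.lookup (v :: 'i \<Rightarrow>\<^sub>0 'w::real_vector) i"
proof -
  have "finite {j. c *\<^sub>R Poly_Mapping.lookup v j \<noteq> 0}"
    by (rule finite_subset[OF _ finite_keys[of v]]) (auto simp: in_keys_iff)
  then show ?thesis
    by (simp add: scaleR_poly_mapping_def Abs_poly_mapping_inverse)
qed

lemma lin_superset:
  assumes "finite S" "Poly_Mapping.keys v \<subseteq> S"
  shows "lin a v = (\<Sum>i\<in>S. Poly_Mapping.lookup v i *\<^sub>R a i)"
  unfolding lin_def using assms by (intro sum.mono_neutral_left) (auto simp: in_keys_iff)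

lemma linear_lin:
  fixes a :: "'i \<Rightarrow> 'w::real_vector"
  shows "linear (lin a)"
proof (rule linearI)
  fix v w :: "'i \<Rightarrow>\<^sub>0 real" and c :: real
  let ?S = "Poly_Mapping.keys v \<union> Poly_Mapping.keys w"
  have "Poly_Mapping.keys (v + w) \<subseteq> ?S" by (rule Poly_Mapping.keys_add)
  then show "lin a (v + w) = lin a v + lin a w"
    by (simp add: lin_superset[of ?S] lookup_add scaleR_add_left sum.distrib)
  have "Poly_Mapping.keys (c *\<^sub>R v) \<subseteq> Poly_Mapping.keys v" by (auto simp: in_keys_iff)
  then show "lin a (c *\<^sub>R v) = c *\<^sub>R lin a v"
    by (simp add: lin_superset[of "Poly_Mapping.keys v"] scaleR_sum_right)
qed

lemmas lin_add = linear_add[OF linear_lin]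
  and lin_diff = linear_diff[OF linear_lin]
  and lin_scale = linear_scale[OF linear_lin]
  and lin_zero [simp] = linear_0[OF linear_lin]

lemma lin_unit_vec [simp]: "lin a (unit_vec i) = a i"
  by (simp add: lin_def unit_vec_def)

lemma lin_cong: "(\<And>i. i \<in> Poly_Mapping.keys v \<Longrightarrow> a i = b i) \<Longrightarrow> lin a v = lin b v"
  by (simp add: lin_def)

lemma linear_apply_lin: "linear f \<Longrightarrow> f (lin a v) = lin (\<lambda>i. f (a i)) v"
  by (simp add: lin_def linear_sum linear_scale)

lemma lin_lin: "lin a (lin b v) = lin (\<lambda>i. lin a (b i)) v"
  by (rule linear_apply_lin[OF linear_lin])

lemma lin_unit_vec_id [simp]: "lin unit_vec v = v"
proof (rule poly_mapping_eqI)
  fix j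
  have "Poly_Mapping.lookup (lin unit_vec v) j =
      (\<Sum>i\<in>Poly_Mapping.keys v. Poly_Mapping.lookup v i * (1 when i = j))"
    by (simp add: lin_def lookup_sum unit_vec_def lookup_single)
  also have "\<dots> = (\<Sum>i\<in>Poly_Mapping.keys v. if i = j then Poly_Mapping.lookup v i else 0)"
    by (intro sum.cong) (auto simp: when_def)
  also have "\<dots> = Poly_Mapping.lookup v j" by (simp add: in_keys_iff)
  finally show "Poly_Mapping.lookup (lin unit_vec v) j = Poly_Mapping.lookup v j" .
qed

text \<open>
  The class norm is the l1 norm.  It is the unit in which the errors of approximate realizations
  are measured, because a bound on the basis vectors propagates to all vectors
  (\<open>seminorm_lin_le\<close> below) with no dependence on the dimension.
\<close>

lemma norm_eq_sum_keys: "norm (v :: 'i \<Rightarrow>\<^sub>0 real) = (\<Sum>i\<in>Poly_Mapping.keys v. \<bar>Poly_Mapping.lookup v i\<bar>)"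
  by (simp add: norm_poly_mapping_def dist_poly_mapping_def)

lemma norm_unit_vec [simp]: "norm (unit_vec i) = 1"
  by (simp add: norm_eq_sum_keys unit_vec_def)

lemma keys_unit_vec [simp]: "Poly_Mapping.keys (unit_vec i) = {i}"
  by (simp add: unit_vec_def)

lemma lookup_unit_vec: "Poly_Mapping.lookup (unit_vec i) j = (if i = j then 1 else 0)"
  by (simp add: unit_vec_def lookup_single when_def)

lemma subspace_supported: "subspace (supported A)"
  unfolding subspace_def supported_def
proof (intro conjI ballI allI)
  fix x y :: "'a \<Rightarrow>\<^sub>0 real" and c
  assume "x \<in> {v. Poly_Mapping.keys v \<subseteq> A}" "y \<in> {v. Poly_Mapping.keys v \<subseteq> A}"
  then show "x + y \<in> {v. Poly_Mapping.keys v \<subseteq> A}" using Poly_Mapping.keys_add[of x y] by auto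
next
  fix x :: "'a \<Rightarrow>\<^sub>0 real" and c
  assume "x \<in> {v. Poly_Mapping.keys v \<subseteq> A}"
  then show "c *\<^sub>R x \<in> {v. Poly_Mapping.keys v \<subseteq> A}" by (auto simp: in_keys_iff)
qed simp

lemmas supported_add = subspace_add[OF subspace_supported]
  and supported_diff = subspace_diff[OF subspace_supported]
  and supported_scale = subspace_scale[OF subspace_supported]
  and supported_zero [simp] = subspace_0[OF subspace_supported]
  and supported_sum = subspace_sum[OF subspace_supported]

lemma unit_vec_in_supported [simp]: "unit_vec i \<in> supported A \<longleftrightarrow> i \<in> A"
  by (simp add: supported_def)

lemma lookup_eq_0_if_supported: "v \<in> supported A \<Longrightarrow> i \<notin> A \<Longrightarrow> Poly_Mapping.lookup v i = 0"
  by (auto simp: supported_def in_keys_iff)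

lemma supported_mono: "A \<subseteq> B \<Longrightarrow> supported A \<subseteq> supported B"
  by (auto simp: supported_def)

lemma lin_fun_upd_supported:
  "v \<in> supported A \<Longrightarrow> i \<notin> A \<Longrightarrow> lin (a(i := z)) v = lin a v"
  by (rule lin_cong) (auto simp: supported_def)

definition seminorm :: "('v::real_vector \<Rightarrow> real) \<Rightarrow> bool" where
  "seminorm N \<longleftrightarrow> (\<forall>x y. N (x + y) \<le> N x + N y) \<and> (\<forall>c x. N (c *\<^sub>R x) = \<bar>c\<bar> * N x)"

lemma
  assumes "seminorm N"
  shows seminorm_add: "N (x + y) \<le> N x + N y"
    and seminorm_scale: "N (c *\<^sub>R x) = \<bar>c\<bar> * N x"
    and seminorm_zero: "N 0 = 0"
    and seminorm_minus: "N (- x) = N x"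
    and seminorm_nonneg: "0 \<le> N x"
proof -
  show a: "N (x + y) \<le> N x + N y" and s: "N (c *\<^sub>R x) = \<bar>c\<bar> * N x" for x y c
    using assms by (auto simp: seminorm_def)
  show z: "N 0 = 0" using s[of 0 0] by simp
  show m: "N (- x) = N x" for x using s[of "-1" x] by simp
  show "0 \<le> N x" using a[of x "- x"] m z by simp
qed

lemma seminorm_sum:
  assumes "seminorm N" shows "N (sum f S) \<le> (\<Sum>i\<in>S. N (f i))"
proof (induction S rule: infinite_finite_induct)
  case (insert x F)
  then show ?case using seminorm_add[OF assms, of "f x" "sum f F"] by simp
qed (simp_all add: seminorm_zero[OF assms])

lemma seminorm_lin_le:
  assumes "seminorm N" "\<And>i. i \<in> Poly_Mapping.keys v \<Longrightarrow> N (a i) \<le> C"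
  shows "N (lin a v) \<le> C * norm v"
proof -
  have "N (lin a v) \<le> (\<Sum>i\<in>Poly_Mapping.keys v. N (Poly_Mapping.lookup v i *\<^sub>R a i))"
    unfolding lin_def by (rule seminorm_sum[OF assms(1)])
  also have "\<dots> \<le> (\<Sum>i\<in>Poly_Mapping.keys v. C * \<bar>Poly_Mapping.lookup v i\<bar>)"
    by (rule sum_mono) (simp add: seminorm_scale[OF assms(1)] assms(2) mult.commute[of _ "N _"] mult_right_mono)
  finally show ?thesis by (simp add: norm_eq_sum_keys sum_distrib_left)
qed

lemma seminorm_norm: "seminorm norm"
  by (simp add: seminorm_def norm_triangle_ineq)

text \<open>
  One inequality for scalar multiples is enough, since it may be applied to \<open>c\<close> and to \<open>1 / c\<close>.
\<close>

lemma seminormI: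
  assumes add: "\<And>x y. N (x + y) \<le> N x + N y" and scale: "\<And>c x. N (c *\<^sub>R x) \<le> \<bar>c\<bar> * N x"
  shows "seminorm N"
  unfolding seminorm_def
proof (intro conjI allI add)
  fix c x
  show "N (c *\<^sub>R x) = \<bar>c\<bar> * N x"
  proof (cases "c = 0")
    case True
    then show ?thesis using add[of 0 0] scale[of 0 x] by simp
  next
    case False
    have "N x \<le> \<bar>1 / c\<bar> * N (c *\<^sub>R x)" using scale[of "1 / c" "c *\<^sub>R x"] False by simp
    then have "\<bar>c\<bar> * N x \<le> N (c *\<^sub>R x)" using False by (simp add: field_simps)
    then show ?thesis using scale[of c x] by simp
  qed
qed

lemma seminorm_SUP:
  assumes N: "\<And>i. i \<in> I \<Longrightarrow> seminorm (N i)" and "I \<noteq> {}" and bdd: "\<And>x. bdd_above ((\<lambda>i. N i x) ` I)"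
  shows "seminorm (\<lambda>x. SUP i\<in>I. N i x)"
proof (rule seminormI)
  fix x y and c :: real
  have up: "N i z \<le> (SUP i\<in>I. N i z)" if "i \<in> I" for i z
    using that bdd by (rule cSUP_upper)
  show "(SUP i\<in>I. N i (x + y)) \<le> (SUP i\<in>I. N i x) + (SUP i\<in>I. N i y)"
    by (rule cSUP_least[OF \<open>I \<noteq> {}\<close>])
      (use seminorm_add[OF N] up in \<open>meson add_mono order_trans\<close>)
  show "(SUP i\<in>I. N i (c *\<^sub>R x)) \<le> \<bar>c\<bar> * (SUP i\<in>I. N i x)"
    by (rule cSUP_least[OF \<open>I \<noteq> {}\<close>]) (simp add: seminorm_scale[OF N] up mult_left_mono)
qed

text \<open>
  The common form of the two amalgamations below: \<open>R x r\<close> says that \<open>x\<close> has a decomposition of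
  cost at most \<open>r\<close>, and the least cost is a seminorm because decompositions can be added and scaled.
\<close>

lemma seminorm_Inf_cost:
  fixes R :: "'v::real_vector \<Rightarrow> real \<Rightarrow> bool"
  assumes tot: "\<And>x. \<exists>r. R x r"
    and nonneg: "\<And>x r. R x r \<Longrightarrow> 0 \<le> r"
    and add: "\<And>x y r s. R x r \<Longrightarrow> R y s \<Longrightarrow> R (x + y) (r + s)"
    and scale: "\<And>x r c. R x r \<Longrightarrow> R (c *\<^sub>R x) (\<bar>c\<bar> * r)"
  shows "seminorm (\<lambda>x. Inf {r. R x r})"
proof -
  let ?N = "\<lambda>x. Inf {r. R x r}"
  have bdd: "bdd_below {r. R x r}" for x using nonneg by (auto intro!: bdd_belowI[of _ 0])
  have low: "?N x \<le> r" if "R x r" for x r using that bdd by (intro cInf_lower) auto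
  have great: "b \<le> ?N x" if "\<And>r. R x r \<Longrightarrow> b \<le> r" for x b
    using tot[of x] that by (intro cInf_greatest) auto
  have le: "?N (c *\<^sub>R x) \<le> \<bar>c\<bar> * ?N x" for c x
  proof (cases "c = 0")
    case True
    obtain r where "R x r" using tot by blast
    from scale[OF this, of 0] low[of "0 *\<^sub>R x" 0] True show ?thesis by simp
  next
    case False
    have "?N (c *\<^sub>R x) / \<bar>c\<bar> \<le> ?N x"
    proof (rule great)
      fix r assume "R x r"
      from low[OF scale[OF this, of c]] False show "?N (c *\<^sub>R x) / \<bar>c\<bar> \<le> r"
        by (simp add: field_simps)
    qed
    then show ?thesis using False by (simp add: field_simps)
  qed
  show ?thesis
  proof (rule seminormI[OF _ le])
    fix x y
    have "?N (x + y) - s \<le> ?N x" if "R y s" for s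
    proof (rule great)
      fix r assume "R x r"
      from low[OF add[OF this that]] show "?N (x + y) - s \<le> r" by simp
    qed
    then have "?N (x + y) - ?N x \<le> ?N y" by (intro great) (auto simp: algebra_simps)
    then show "?N (x + y) \<le> ?N x + ?N y" by simp
  qed
qed

lemma
  fixes R :: "'v \<Rightarrow> real \<Rightarrow> bool"
  assumes "\<And>r. R x r \<Longrightarrow> 0 \<le> r"
  shows Inf_cost_le: "R x r \<Longrightarrow> Inf {r. R x r} \<le> r"
    and Inf_cost_ge: "(\<exists>r. R x r) \<Longrightarrow> (\<And>r. R x r \<Longrightarrow> b \<le> r) \<Longrightarrow> b \<le> Inf {r. R x r}"
  using assms by (auto intro!: cInf_lower cInf_greatest bdd_belowI[of _ 0])

section \<open>Almost isometric maps into the Gurarij space\<close>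

lemma linear_map_on_linear: "linear f \<Longrightarrow> linear_map_on V f"
  by (simp add: linear_map_on_def linear_add linear_scale)

lemma linear_map_on_lin:
  assumes "linear_map_on V f" "subspace V" "Poly_Mapping.keys v \<subseteq> {i. a i \<in> V}"
  shows "f (lin a v) = lin (\<lambda>i. f (a i)) v"
proof -
  have add: "\<And>x y. x \<in> V \<Longrightarrow> y \<in> V \<Longrightarrow> f (x + y) = f x + f y"
    and scale: "\<And>x c. x \<in> V \<Longrightarrow> f (c *\<^sub>R x) = c *\<^sub>R f x"
    using assms(1) by (auto simp: linear_map_on_def)
  have "f (\<Sum>i\<in>S. Poly_Mapping.lookup v i *\<^sub>R a i) = (\<Sum>i\<in>S. Poly_Mapping.lookup v i *\<^sub>R f (a i))"
    if "finite S" "S \<subseteq> {i. a i \<in> V}" for S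
    using that
  proof (induction S rule: finite_induct)
    case empty
    then show ?case using scale[of 0 0] subspace_0[OF assms(2)] by simp
  next
    case (insert j S)
    have "(\<Sum>i\<in>S. Poly_Mapping.lookup v i *\<^sub>R a i) \<in> V"
      using insert.prems assms(2) by (intro subspace_sum subspace_scale) auto
    with insert show ?case using assms(2) by (simp add: add scale subspace_scale)
  qed
  from this[of "Poly_Mapping.keys v"] assms(3) show ?thesis by (simp add: lin_def)
qed

text \<open>
  The extension property, transported along a linear embedding so that the finite-dimensional
  space may live in any real vector space.
\<close>

lemma gurarij_extension:
  fixes f :: "'v::real_vector \<Rightarrow> 'g::banach"
  assumes "gurarij_space TYPE('g)" "finite B" "norm_on (span B) N"
    and "subspace E" "E \<subseteq> span B" "linear_map_on E f" "\<And>x. x \<in> E \<Longrightarrow> norm (f x) = N x"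
    and "0 < \<epsilon>"
  obtains f' :: "'v \<Rightarrow> 'g" where "linear_map_on (span B) f'" "\<And>x. x \<in> E \<Longrightarrow> f' x = f x"
    and "\<And>x. x \<in> span B \<Longrightarrow> inverse (1 + \<epsilon>) * N x \<le> norm (f' x)"
    and "\<And>x. x \<in> span B \<Longrightarrow> norm (f' x) \<le> (1 + \<epsilon>) * N x"
proof -
  obtain h :: "'v \<Rightarrow> (nat \<Rightarrow>\<^sub>0 real)" where h: "linear h" "inj_on h (span B)"
    using finite_dim_embeds[OF assms(2)] by blast
  define k where "k = inv_into (span B) h"
  have kh: "k (h x) = x" if "x \<in> span B" for x
    unfolding k_def using h(2) that by (rule inv_into_f_f)
  have F: "h ` span B = span (h ` B)" by (simp add: linear_span_image h(1))
  have hadd: "h (x + y) = h x + h y" and hscale: "h (c *\<^sub>R x) = c *\<^sub>R h x" for x y c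
    using h(1) by (simp_all add: linear_add linear_scale)
  have k_add: "k (h x + h y) = x + y" if "x \<in> span B" "y \<in> span B" for x y
    using kh[of "x + y"] that by (simp add: span_add hadd)
  have k_scale: "k (c *\<^sub>R h x) = c *\<^sub>R x" if "x \<in> span B" for x c
    using kh[of "c *\<^sub>R x"] that by (simp add: span_scale hscale)
  have N: "\<And>x. x \<in> span B \<Longrightarrow> 0 \<le> N x \<and> (N x = 0 \<longleftrightarrow> x = 0)"
     "\<And>x c. x \<in> span B \<Longrightarrow> N (c *\<^sub>R x) = \<bar>c\<bar> * N x"
     "\<And>x y. x \<in> span B \<Longrightarrow> y \<in> span B \<Longrightarrow> N (x + y) \<le> N x + N y"
    using assms(3) by (auto simp: norm_on_def)
  have h0: "h x = 0 \<longleftrightarrow> x = 0" if "x \<in> span B" for x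
    using h that by (metis kh linear_0 span_zero)
  have fd: "finite_dim_normed (h ` span B) (\<lambda>x. N (k x))"
    unfolding finite_dim_normed_def norm_on_def
  proof (intro conjI)
    show "subspace (h ` span B)" by (simp add: F)
    show "\<exists>Ba. finite Ba \<and> h ` span B = span Ba" using F assms(2) by blast
  qed (auto simp: kh k_add k_scale N h0)
  have subE: "x \<in> span B" if "x \<in> E" for x using that assms(5) by blast
  have E: "subspace (h ` E)" "h ` E \<subseteq> h ` span B"
    using linear_subspace_image[OF h(1) assms(4)] assms(5) by auto
  have f: "linear_map_on (h ` E) (\<lambda>x. f (k x))" "\<forall>x\<in>h ` E. norm (f (k x)) = N (k x)"
    using assms(6,7) by (auto simp: linear_map_on_def kh k_add k_scale subE)
  have "\<exists>f' :: (nat \<Rightarrow>\<^sub>0 real) \<Rightarrow> 'g. linear_map_on (h ` span B) f' \<and> (\<forall>x\<in>h ` E. f' x = f (k x)) \<and>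
      (\<forall>x\<in>h ` span B. inverse (1 + \<epsilon>) * N (k x) \<le> norm (f' x) \<and> norm (f' x) \<le> (1 + \<epsilon>) * N (k x))"
    using assms(1,8) fd E f unfolding gurarij_space_def by blast
  then obtain f' where f': "linear_map_on (h ` span B) f'" "\<forall>x\<in>h ` E. f' x = f (k x)"
      "\<forall>x\<in>h ` span B. inverse (1 + \<epsilon>) * N (k x) \<le> norm (f' x) \<and> norm (f' x) \<le> (1 + \<epsilon>) * N (k x)"
    by blast
  show ?thesis
  proof (rule that[of "\<lambda>x. f' (h x)"])
    show "linear_map_on (span B) (\<lambda>x. f' (h x))"
      using f'(1) by (auto simp: linear_map_on_def hadd hscale)
  qed (use f' in \<open>auto simp: kh subE\<close>)
qed

text \<open>
  Decompose \<open>(z, w)\<close> as \<open>(z + lin a v, 0) + (0, w - v) + (- lin a v, v)\<close> and charge \<open>\<epsilon> * norm v\<close>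
  for the last part: the largest seminorm on the direct sum that is bounded by
  \<open>norm\<close> and by \<open>N\<close> on the two summands and puts \<open>unit_vec i\<close>, \<open>i \<in> A\<close>, within \<open>\<epsilon>\<close> of \<open>a i\<close>.
\<close>

definition glue_cost ::
    "('i \<Rightarrow> 'g::real_normed_vector) \<Rightarrow> (('i \<Rightarrow>\<^sub>0 real) \<Rightarrow> real) \<Rightarrow> 'i set \<Rightarrow> real \<Rightarrow> 'g \<times> ('i \<Rightarrow>\<^sub>0 real) \<Rightarrow> real \<Rightarrow> bool" where
  "glue_cost a N A \<epsilon> x r \<longleftrightarrow>
     (\<exists>v\<in>supported A. norm (fst x + lin a v) + N (snd x - v) + \<epsilon> * norm v \<le> r)"

text \<open>
  The charge \<open>\<epsilon> * norm v\<close> is exactly what makes up for replacing \<open>N v\<close> by \<open>norm (lin a v)\<close> or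
  conversely, so that neither summand is shrunk by the gluing.  This turns an almost isometric
  map into an isometric one at the price of a small displacement.
\<close>

lemma glued_seminorm:
  fixes a :: "'i \<Rightarrow> 'g::real_normed_vector"
  assumes N: "seminorm N" and "0 \<le> \<epsilon>"
    and close: "\<And>v. v \<in> supported A \<Longrightarrow> \<bar>N v - norm (lin a v)\<bar> \<le> \<epsilon> * norm v"
  obtains M where "seminorm M" "\<And>z. M (z, 0) = norm z" "\<And>w. M (0, w) = N w"
    "\<And>i. i \<in> A \<Longrightarrow> M (- a i, unit_vec i) \<le> \<epsilon>"
proof -
  let ?R = "glue_cost a N A \<epsilon>"
  note [simp] = seminorm_zero[OF N] seminorm_nonneg[OF N]
  have nonneg: "0 \<le> r" if "?R x r" for x r
    using that \<open>0 \<le> \<epsilon>\<close> unfolding glue_cost_def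
    by (smt (verit) mult_nonneg_nonneg norm_ge_zero seminorm_nonneg[OF N])
  have at0: "?R (z, w) (norm z + N w)" for z w
    by (auto simp: glue_cost_def intro: bexI[of _ 0])
  have tot: "\<exists>r. ?R x r" for x using at0[of "fst x" "snd x"] by auto
  have semi: "seminorm (\<lambda>x. Inf {r. ?R x r})"
  proof (rule seminorm_Inf_cost[OF tot nonneg])
    fix x y r s assume "?R x r" "?R y s"
    then obtain v w where v: "v \<in> supported A" "norm (fst x + lin a v) + N (snd x - v) + \<epsilon> * norm v \<le> r"
      and w: "w \<in> supported A" "norm (fst y + lin a w) + N (snd y - w) + \<epsilon> * norm w \<le> s"
      by (auto simp: glue_cost_def)
    have "norm (fst (x + y) + lin a (v + w)) \<le> norm (fst x + lin a v) + norm (fst y + lin a w)"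
      using norm_triangle_ineq[of "fst x + lin a v" "fst y + lin a w"] by (simp add: lin_add algebra_simps)
    moreover have "N (snd (x + y) - (v + w)) \<le> N (snd x - v) + N (snd y - w)"
      using seminorm_add[OF N, of "snd x - v" "snd y - w"] by (simp add: algebra_simps)
    moreover have "\<epsilon> * norm (v + w) \<le> \<epsilon> * norm v + \<epsilon> * norm w"
      using mult_left_mono[OF norm_triangle_ineq[of v w] \<open>0 \<le> \<epsilon>\<close>] by (simp add: algebra_simps)
    ultimately show "?R (x + y) (r + s)"
      unfolding glue_cost_def using v w by (intro bexI[of _ "v + w"] supported_add) linarith+
  next
    fix x r and c :: real assume "?R x r"
    then obtain v where v: "v \<in> supported A" "norm (fst x + lin a v) + N (snd x - v) + \<epsilon> * norm v \<le> r"
      by (auto simp: glue_cost_def)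
    have "norm (fst (c *\<^sub>R x) + lin a (c *\<^sub>R v)) = \<bar>c\<bar> * norm (fst x + lin a v)"
      by (simp add: lin_scale flip: scaleR_add_right)
    moreover have "N (snd (c *\<^sub>R x) - c *\<^sub>R v) = \<bar>c\<bar> * N (snd x - v)"
      by (simp add: seminorm_scale[OF N] flip: scaleR_diff_right)
    ultimately show "?R (c *\<^sub>R x) (\<bar>c\<bar> * r)"
      using v(1) mult_left_mono[OF v(2), of "\<bar>c\<bar>"] unfolding glue_cost_def
      by (intro bexI[of _ "c *\<^sub>R v"]) (auto simp: algebra_simps supported_scale)
  qed
  show ?thesis
  proof (rule that[OF semi])
    fix z :: 'g
    have "norm z \<le> r" if r: "?R (z, 0) r" for r
    proof -
      obtain v where v: "v \<in> supported A" "norm (z + lin a v) + N (- v) + \<epsilon> * norm v \<le> r"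
        using r by (auto simp: glue_cost_def)
      then show ?thesis
        using close[OF v(1)] norm_diff_ineq[of z "lin a v"] by (simp add: seminorm_minus[OF N])
    qed
    moreover have "?R (z, 0) (norm z)" using at0[of z 0] by simp
    ultimately show "Inf {r. ?R (z, 0) r} = norm z"
      using Inf_cost_le[of ?R "(z, 0)"] Inf_cost_ge[of ?R "(z, 0)"] nonneg by (intro antisym) blast+
  next
    fix w
    have "N w \<le> r" if r: "?R (0, w) r" for r
    proof -
      obtain v where v: "v \<in> supported A" "norm (lin a v) + N (w - v) + \<epsilon> * norm v \<le> r"
        using r by (auto simp: glue_cost_def)
      then show ?thesis
        using close[OF v(1)] seminorm_add[OF N, of v "w - v"] by simp
    qed
    moreover have "?R (0, w) (N w)" using at0[of 0 w] by simp
    ultimately show "Inf {r. ?R (0, w) r} = N w"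
      using Inf_cost_le[of ?R "(0, w)"] Inf_cost_ge[of ?R "(0, w)"] nonneg by (intro antisym) blast+
  next
    fix i assume "i \<in> A"
    then have "?R (- a i, unit_vec i) \<epsilon>"
      unfolding glue_cost_def by (intro bexI[of _ "unit_vec i"]) auto
    then show "Inf {r. ?R (- a i, unit_vec i) r} \<le> \<epsilon>"
      using Inf_cost_le[of ?R "(- a i, unit_vec i)"] nonneg by blast
  qed
qed

text \<open>
  The forth step.  In the glued space the span of the \<open>a i\<close> is isometrically a subspace of the
  Gurarij space; extending its inclusion over the basis vectors \<open>unit_vec i\<close>, \<open>i \<in> A'\<close>, gives the
  new images.  The old accuracy \<open>\<epsilon>\<close> bounds how far images move, while the new accuracy \<open>\<epsilon>'\<close> is
  arbitrary: this independence makes the iteration converge.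
\<close>

lemma improve_realization:
  fixes a :: "'i \<Rightarrow> 'g::banach"
  assumes G: "gurarij_space TYPE('g)" and N: "seminorm N" and \<epsilon>: "0 < \<epsilon>" and \<epsilon>': "0 < \<epsilon>'"
    and A: "finite A'" "A \<subseteq> A'"
    and close: "\<And>v. v \<in> supported A \<Longrightarrow> \<bar>N v - norm (lin a v)\<bar> \<le> \<epsilon> * norm v"
  obtains a' where "\<And>i. i \<in> A \<Longrightarrow> norm (a' i - a i) \<le> 2 * \<epsilon>"
    and "\<And>v. v \<in> supported A' \<Longrightarrow> \<bar>N v - norm (lin a' v)\<bar> \<le> \<epsilon>' * norm v"
proof -
  obtain M where M: "seminorm M" "\<And>z. M (z, 0) = norm z" "\<And>w. M (0, w) = N w"
    "\<And>i. i \<in> A \<Longrightarrow> M (- a i, unit_vec i) \<le> \<epsilon>"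
    using glued_seminorm[OF N less_imp_le[OF \<epsilon>] close] by blast
  define C where "C = (\<Sum>i\<in>A'. N (unit_vec i))"
  have C0: "0 \<le> C" unfolding C_def by (simp add: sum_nonneg seminorm_nonneg[OF N])
  have NC: "N v \<le> C * norm v" if "v \<in> supported A'" for v
  proof -
    have "N (lin unit_vec v) \<le> C * norm v"
    proof (rule seminorm_lin_le[OF N])
      fix i assume "i \<in> Poly_Mapping.keys v"
      then have "i \<in> A'" using that by (auto simp: supported_def)
      then show "N (unit_vec i) \<le> C"
        unfolding C_def using A(1) by (intro member_le_sum) (auto simp: seminorm_nonneg[OF N])
    qed
    then show ?thesis by simp
  qed
  \<comment> \<open>\<open>\<eta>\<close> perturbs the glued seminorm to a norm; \<open>\<delta>\<close> is the distortion allowed to the extension.\<close>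
  define \<eta> where "\<eta> = min (\<epsilon> / 4) (\<epsilon>' / 4)"
  define \<delta> where "\<delta> = min (1 / 2) (\<epsilon>' / (2 * (C + 1)))"
  have \<eta>: "0 < \<eta>" "\<eta> \<le> \<epsilon> / 4" "\<eta> \<le> \<epsilon>' / 4" using \<epsilon> \<epsilon>' by (auto simp: \<eta>_def)
  have \<delta>: "0 < \<delta>" "\<delta> \<le> 1 / 2" "\<delta> \<le> \<epsilon>' / (2 * (C + 1))"
  proof -
    show "0 < \<delta>" using \<epsilon>' C0 by (simp add: \<delta>_def)
    show "\<delta> \<le> 1 / 2" unfolding \<delta>_def by (rule min.cobounded1)
    show "\<delta> \<le> \<epsilon>' / (2 * (C + 1))" unfolding \<delta>_def by (rule min.cobounded2)
  qed
  have \<delta>C: "\<delta> * C \<le> \<epsilon>' / 2"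
  proof -
    have "\<delta> * (C + 1) \<le> \<epsilon>' / 2" using \<delta>(3) C0 by (simp add: field_simps)
    then show ?thesis using \<delta>(1) by (simp add: algebra_simps)
  qed
  \<comment> \<open>Definite, yet unchanged on the first summand, where the map to be extended must be isometric.\<close>
  define M' where "M' = (\<lambda>x. M x + \<eta> * norm (snd x))"
  define B where "B = (\<lambda>i. (a i, 0 :: 'i \<Rightarrow>\<^sub>0 real)) ` A \<union> (\<lambda>i. (0 :: 'g, unit_vec i)) ` A'"
  have "finite A" using A finite_subset by blast
  then have "finite B" using A(1) by (simp add: B_def)
  have norm_M': "norm_on (span B) M'"
    unfolding norm_on_def M'_def
  proof (intro conjI ballI allI)
    fix x
    show "0 \<le> M x + \<eta> * norm (snd x)" using \<eta>(1) by (simp add: seminorm_nonneg[OF M(1)])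
    show "(M x + \<eta> * norm (snd x) = 0) = (x = 0)"
    proof
      assume "M x + \<eta> * norm (snd x) = 0"
      then have "M x = 0 \<and> \<eta> * norm (snd x) = 0"
        using seminorm_nonneg[OF M(1), of x] \<eta>(1) by (smt (verit) mult_nonneg_nonneg norm_ge_zero)
      then have "snd x = 0" "M x = 0" using \<eta>(1) by auto
      then have "norm (fst x) = 0" using M(2)[of "fst x"] by (cases x) simp
      then show "x = 0" using \<open>snd x = 0\<close> by (simp add: prod_eq_iff)
    qed (simp add: seminorm_zero[OF M(1)])
  next
    fix x :: "'g \<times> ('i \<Rightarrow>\<^sub>0 real)" and c
    show "M (c *\<^sub>R x) + \<eta> * norm (snd (c *\<^sub>R x)) = \<bar>c\<bar> * (M x + \<eta> * norm (snd x))"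
      by (simp add: seminorm_scale[OF M(1)] algebra_simps)
  next
    fix x y :: "'g \<times> ('i \<Rightarrow>\<^sub>0 real)"
    have "\<eta> * norm (snd x + snd y) \<le> \<eta> * (norm (snd x) + norm (snd y))"
      using \<eta>(1) by (intro mult_left_mono norm_triangle_ineq) auto
    then show "M (x + y) + \<eta> * norm (snd (x + y)) \<le>
        M x + \<eta> * norm (snd x) + (M y + \<eta> * norm (snd y))"
      using seminorm_add[OF M(1), of x y] by (simp add: algebra_simps)
  qed
  define E where "E = span ((\<lambda>i. (a i, 0 :: 'i \<Rightarrow>\<^sub>0 real)) ` A)"
  have "subspace E" by (simp add: E_def)
  have EB: "E \<subseteq> span B" unfolding E_def B_def by (intro span_mono) auto
  have E0: "snd x = 0" if "x \<in> E" for x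
  proof -
    have "E \<subseteq> {x. snd x = 0}" unfolding E_def
      by (rule span_minimal) (auto simp: subspace_def)
    then show ?thesis using that by blast
  qed
  have iso: "norm (fst x) = M' x" if "x \<in> E" for x
    using E0[OF that] M(2)[of "fst x"] by (cases x) (simp add: M'_def)
  obtain f' where f': "linear_map_on (span B) f'" "\<And>x. x \<in> E \<Longrightarrow> f' x = fst x"
    "\<And>x. x \<in> span B \<Longrightarrow> inverse (1 + \<delta>) * M' x \<le> norm (f' x)"
    "\<And>x. x \<in> span B \<Longrightarrow> norm (f' x) \<le> (1 + \<delta>) * M' x"
    using gurarij_extension[OF G \<open>finite B\<close> norm_M' \<open>subspace E\<close> EB linear_map_on_linear[OF linear_fst] iso \<delta>(1)]
    by blast
  show ?thesis
  proof (rule that[of "\<lambda>i. f' (0, unit_vec i)"])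
    fix i assume i: "i \<in> A"
    have m: "(a i, 0) \<in> E" "(a i, 0) \<in> span B" "(0, unit_vec i) \<in> span B"
      using i A(2) EB by (auto simp: E_def B_def intro!: span_base)
    have neg: "(- a i, 0) \<in> E" "(- a i, 0) \<in> span B"
      using subspace_neg[OF \<open>subspace E\<close> m(1)] EB by auto
    have sum: "(- a i, unit_vec i) = (0, unit_vec i) + (- a i, 0)" by simp
    have "f' (- a i, unit_vec i) = f' (0, unit_vec i) + f' (- a i, 0)"
      unfolding sum using f'(1) m(3) neg(2) unfolding linear_map_on_def by blast
    also have "\<dots> = f' (0, unit_vec i) - a i" using f'(2)[OF neg(1)] by simp
    finally have "norm (f' (0, unit_vec i) - a i) = norm (f' (- a i, unit_vec i))" by simp
    also have "\<dots> \<le> (1 + \<delta>) * M' (- a i, unit_vec i)"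
      using f'(4) span_add[OF m(3) neg(2)] by simp
    also have "\<dots> \<le> (3 / 2) * (\<epsilon> + \<epsilon> / 4)"
      using \<delta> \<eta> M(4)[OF i] \<epsilon> seminorm_nonneg[OF M(1), of "(- a i, unit_vec i)"]
      by (intro mult_mono) (auto simp: M'_def)
    also have "\<dots> \<le> 2 * \<epsilon>" using \<epsilon> by simp
    finally show "norm (f' (0, unit_vec i) - a i) \<le> 2 * \<epsilon>" .
  next
    fix v assume v: "v \<in> supported A'"
    have zv: "(0, v) = lin (\<lambda>i. (0::'g, unit_vec i)) v"
    proof -
      have "linear (\<lambda>w. (0::'g, w :: 'i \<Rightarrow>\<^sub>0 real))" by (rule linearI) auto
      from linear_apply_lin[OF this, of unit_vec v] show ?thesis by simp
    qed
    have keys: "Poly_Mapping.keys v \<subseteq> {i. (0::'g, unit_vec i) \<in> span B}"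
      using v by (auto simp: B_def supported_def intro!: span_base)
    have "lin (\<lambda>i. f' (0, unit_vec i)) v = f' (0, v)"
      unfolding zv by (rule linear_map_on_lin[OF f'(1) _ keys, symmetric]) simp
    moreover have "(0, v) \<in> span B"
      unfolding zv lin_def using keys by (intro span_sum span_scale) auto
    ultimately have b: "inverse (1 + \<delta>) * (N v + \<eta> * norm v) \<le> norm (lin (\<lambda>i. f' (0, unit_vec i)) v)"
      "norm (lin (\<lambda>i. f' (0, unit_vec i)) v) \<le> (1 + \<delta>) * (N v + \<eta> * norm v)"
      using f'(3,4)[of "(0, v)"] by (auto simp: M'_def M(3))
    have \<delta>N: "\<delta> * N v \<le> \<epsilon>' / 2 * norm v"
    proof -
      have "\<delta> * N v \<le> \<delta> * (C * norm v)" using NC[OF v] \<delta>(1) by (intro mult_left_mono) auto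
      also have "\<dots> = (\<delta> * C) * norm v" by simp
      also have "\<dots> \<le> \<epsilon>' / 2 * norm v" using \<delta>C by (intro mult_right_mono) auto
      finally show ?thesis .
    qed
    have up: "(1 + \<delta>) * (N v + \<eta> * norm v) \<le> N v + \<epsilon>' * norm v"
    proof -
      have "(1 + \<delta>) * (\<eta> * norm v) \<le> (3 / 2) * (\<epsilon>' / 4 * norm v)"
        using \<delta> \<eta> by (intro mult_mono mult_right_mono) auto
      moreover have "(3 / 2) * (\<epsilon>' / 4 * norm v) \<le> \<epsilon>' / 2 * norm v"
        using \<epsilon>' by simp
      ultimately show ?thesis using \<delta>N by (simp add: algebra_simps)
    qed
    have low: "N v - \<epsilon>' * norm v \<le> inverse (1 + \<delta>) * (N v + \<eta> * norm v)"
    proof -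
      have "1 - \<delta> \<le> inverse (1 + \<delta>)" using \<delta> by (simp add: field_simps)
      then have "(1 - \<delta>) * N v \<le> inverse (1 + \<delta>) * N v"
        by (intro mult_right_mono) (auto simp: seminorm_nonneg[OF N])
      also have "\<dots> \<le> inverse (1 + \<delta>) * (N v + \<eta> * norm v)"
        using \<delta> \<eta> by (intro mult_left_mono) auto
      finally have "N v - \<delta> * N v \<le> inverse (1 + \<delta>) * (N v + \<eta> * norm v)" by (simp add: algebra_simps)
      moreover have "0 \<le> \<epsilon>' * norm v" using \<epsilon>' by simp
      ultimately show ?thesis using \<delta>N by linarith
    qed
    show "\<bar>N v - norm (lin (\<lambda>i. f' (0, unit_vec i)) v)\<bar> \<le> \<epsilon>' * norm v"
      using b up low by linarith
  qed
qed

section \<open>Invariant seminorms on free modules\<close>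

text \<open>
  The index \<open>(j, g)\<close> stands for the translate by \<open>g\<close> of the \<open>j\<close>-th generator of a free module.
  Indices outside the carrier are left fixed, so that the identity \<open>shift_one\<close> and hence the
  action laws hold on the whole space.
\<close>

definition shift :: "('a, 'b) monoid_scheme \<Rightarrow> 'a \<Rightarrow> nat \<times> 'a \<Rightarrow> nat \<times> 'a" where
  "shift G g i = (if snd i \<in> carrier G then (fst i, g \<otimes>\<^bsub>G\<^esub> snd i) else i)"

definition translate :: "('a, 'b) monoid_scheme \<Rightarrow> 'a \<Rightarrow> (nat \<times> 'a \<Rightarrow>\<^sub>0 real) \<Rightarrow> (nat \<times> 'a \<Rightarrow>\<^sub>0 real)" where
  "translate G g v = lin (\<lambda>i. unit_vec (shift G g i)) v"

definition gens :: "('a, 'b) monoid_scheme \<Rightarrow> nat \<Rightarrow> (nat \<times> 'a) set" where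
  "gens G k = {..<k} \<times> carrier G"

lemma linear_translate: "linear (translate G g)"
  unfolding translate_def[abs_def] by (rule linear_lin)

lemmas translate_add = linear_add[OF linear_translate]
  and translate_scale = linear_scale[OF linear_translate]
  and translate_sum = linear_sum[OF linear_translate]
  and translate_zero [simp] = linear_0[OF linear_translate]

lemma translate_unit_vec [simp]: "translate G g (unit_vec i) = unit_vec (shift G g i)"
  by (simp add: translate_def)

lemma lin_translate: "lin a (translate G g v) = lin (\<lambda>i. a (shift G g i)) v"
  by (simp add: translate_def lin_lin)

lemma lookup_eq_lin: "Poly_Mapping.lookup v j = lin (\<lambda>i. if i = j then 1 else 0) v"
proof -
  have "linear (\<lambda>w :: 'a \<Rightarrow>\<^sub>0 real. Poly_Mapping.lookup w j)"
    by (rule linearI) (simp_all add: lookup_add)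
  from linear_apply_lin[OF this, of unit_vec v] show ?thesis by (simp add: lookup_unit_vec)
qed

context group
begin

lemma shift_shift: "g \<in> carrier G \<Longrightarrow> h \<in> carrier G \<Longrightarrow> shift G g (shift G h i) = shift G (g \<otimes> h) i"
  by (auto simp: shift_def m_assoc)

lemma shift_one: "shift G \<one> i = i"
  by (simp add: shift_def)

lemma translate_translate:
  "g \<in> carrier G \<Longrightarrow> h \<in> carrier G \<Longrightarrow> translate G g (translate G h v) = translate G (g \<otimes> h) v"
  using lin_translate[of "\<lambda>i. unit_vec (shift G g i)" G h v] by (simp add: translate_def shift_shift)

lemma translate_one [simp]: "translate G \<one> v = v"
  by (simp add: translate_def shift_one)

lemma lookup_translate:
  assumes "g \<in> carrier G"
  shows "Poly_Mapping.lookup (translate G g v) j = Poly_Mapping.lookup v (shift G (inv g) j)"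
proof -
  have "shift G g i = j \<longleftrightarrow> i = shift G (inv g) j" for i
    using assms shift_shift[of g "inv g" j] shift_shift[of "inv g" g i] by (auto simp: shift_one)
  then show ?thesis by (simp add: lookup_eq_lin lin_translate)
qed

lemma translate_supported:
  assumes "g \<in> carrier G" "v \<in> supported (K \<times> carrier G)"
  shows "translate G g v \<in> supported (K \<times> carrier G)"
  using assms(2) unfolding translate_def lin_def
  by (intro supported_sum supported_scale) (auto simp: supported_def shift_def assms(1))

text \<open>
  Vanishing outside the first \<open>k\<close> generators lets all stages of the construction live on one space.
\<close>

definition invariant_seminorm :: "nat \<Rightarrow> ((nat \<times> 'a \<Rightarrow>\<^sub>0 real) \<Rightarrow> real) \<Rightarrow> bool" where
  "invariant_seminorm k N \<longleftrightarrow> seminorm N \<and> (\<forall>g\<in>carrier G. \<forall>v. N (translate G g v) = N v) \<and>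
     (\<forall>i. i \<notin> gens G k \<longrightarrow> N (unit_vec i) = 0)"

text \<open>
  The amalgamated seminorm for a new generator \<open>k\<close>: a vector is written as \<open>w0\<close>, which does not
  involve the new generator and costs \<open>N w0\<close>, plus translates of vectors \<open>p g\<close> from the
  finite-dimensional piece spanned by \<open>A\<close>, which cost \<open>Q (p g)\<close>.  Allowing all translates makes the
  result invariant; collecting the terms with the same translate makes \<open>p\<close> a function of \<open>g\<close>.
\<close>

definition free_cost ::
    "((nat \<times> 'a \<Rightarrow>\<^sub>0 real) \<Rightarrow> real) \<Rightarrow> ((nat \<times> 'a \<Rightarrow>\<^sub>0 real) \<Rightarrow> real) \<Rightarrow> (nat \<times> 'a) set
      \<Rightarrow> nat \<Rightarrow> (nat \<times> 'a \<Rightarrow>\<^sub>0 real) \<Rightarrow> real \<Rightarrow> bool" where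
  "free_cost N Q A k w r \<longleftrightarrow>
     (\<exists>w0 p S. finite S \<and> S \<subseteq> carrier G \<and> (\<forall>g. p g \<in> supported A) \<and> (\<forall>g. g \<notin> S \<longrightarrow> p g = 0) \<and>
        (\<forall>g\<in>carrier G. Poly_Mapping.lookup w0 (k, g) = 0) \<and>
        w = w0 + (\<Sum>g\<in>S. translate G g (p g)) \<and> N w0 + (\<Sum>g\<in>S. Q (p g)) \<le> r)"

text \<open>
  The pieces \<open>p g\<close> see the new generator only at \<open>(k, \<one>)\<close>, and the \<open>g\<close>-th translate carries this
  coordinate to \<open>(k, g)\<close>; hence the coordinates of the sum at the new generator determine those of
  each piece.
\<close>

lemma lookup_sum_translates:
  assumes "finite S" "S \<subseteq> carrier G" "\<And>g. p g \<in> supported (insert (k, \<one>) A)" "\<And>g. g \<notin> S \<Longrightarrow> p g = 0"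
    and "A \<subseteq> gens G k" "h \<in> carrier G"
  shows "Poly_Mapping.lookup (\<Sum>g\<in>S. translate G g (p g)) (k, h) = Poly_Mapping.lookup (p h) (k, \<one>)"
proof -
  have "Poly_Mapping.lookup (translate G g (p g)) (k, h) =
      (if g = h then Poly_Mapping.lookup (p h) (k, \<one>) else 0)" if "g \<in> S" for g
  proof -
    have g: "g \<in> carrier G" using that assms(2) by blast
    have "Poly_Mapping.lookup (p g) (k, inv g \<otimes> h) = 0" if "g \<noteq> h"
    proof (rule lookup_eq_0_if_supported[OF assms(3)])
      have "inv g \<otimes> h \<noteq> \<one>" using that g assms(6) by (metis inv_solve_left one_closed r_one)
      then show "(k, inv g \<otimes> h) \<notin> insert (k, \<one>) A" using assms(5) by (auto simp: gens_def)
    qed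
    then show ?thesis using g assms(6) by (auto simp: lookup_translate shift_def)
  qed
  then have "Poly_Mapping.lookup (\<Sum>g\<in>S. translate G g (p g)) (k, h) =
      (\<Sum>g\<in>S. if g = h then Poly_Mapping.lookup (p h) (k, \<one>) else 0)"
    by (simp add: lookup_sum)
  then show ?thesis using assms(1,4) by simp
qed

text \<open>
  The back step.  A piece costs the norm of its image, the new generator going to \<open>z\<close>, plus \<open>\<epsilon>\<close>
  times its own norm.  On \<open>supported A\<close> this dominates \<open>N\<close>, so splitting off a piece without the
  new generator never lowers the cost.  So for a vector of the old module every piece may be absorbed into \<open>w0\<close>,
  and for a vector of \<open>supported (insert (k, \<one>) A)\<close> every piece except the one at \<open>\<one>\<close>; the
  remaining difference lies in \<open>supported A\<close>, where \<open>N\<close> is known up to \<open>\<epsilon>\<close>.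
\<close>

lemma adjoin_generator:
  fixes a :: "nat \<times> 'a \<Rightarrow> 'g::real_normed_vector"
  assumes inv_N: "invariant_seminorm k N" and \<epsilon>: "0 \<le> \<epsilon>"
    and A: "A \<subseteq> gens G k"
    and close: "\<And>v. v \<in> supported A \<Longrightarrow> \<bar>N v - norm (lin a v)\<bar> \<le> \<epsilon> * norm v"
  obtains N' where "invariant_seminorm (Suc k) N'"
    "\<And>v. v \<in> supported (gens G k) \<Longrightarrow> N' v = N v"
    "\<And>v. v \<in> supported (insert (k, \<one>) A) \<Longrightarrow>
       \<bar>N' v - norm (lin (a((k, \<one>) := z)) v)\<bar> \<le> \<epsilon> * norm v"
proof -
  have N: "seminorm N" and inv: "\<And>g v. g \<in> carrier G \<Longrightarrow> N (translate G g v) = N v"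
    and vanish: "\<And>i. i \<notin> gens G k \<Longrightarrow> N (unit_vec i) = 0"
    using inv_N by (auto simp: invariant_seminorm_def)
  define a' where "a' = a((k, \<one>) := z)"
  define A' where "A' = insert (k, \<one>) A"
  define Q where "Q = (\<lambda>v. norm (lin a' v) + \<epsilon> * norm v)"
  let ?R = "free_cost N Q A' k"
  note [simp] = seminorm_zero[OF N] seminorm_nonneg[OF N]
  have kA: "(k, \<one>) \<notin> A" using A by (auto simp: gens_def)
  have Q: "seminorm Q"
    unfolding seminorm_def Q_def
  proof (intro conjI allI)
    fix x y :: "nat \<times> 'a \<Rightarrow>\<^sub>0 real"
    have "\<epsilon> * norm (x + y) \<le> \<epsilon> * norm x + \<epsilon> * norm y"
      using mult_left_mono[OF norm_triangle_ineq[of x y] \<epsilon>] by (simp add: algebra_simps)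
    then show "norm (lin a' (x + y)) + \<epsilon> * norm (x + y) \<le>
        norm (lin a' x) + \<epsilon> * norm x + (norm (lin a' y) + \<epsilon> * norm y)"
      using norm_triangle_ineq[of "lin a' x" "lin a' y"] by (simp add: lin_add)
  qed (simp add: lin_scale algebra_simps)
  have R_I: "?R w r"
    if "finite S" "S \<subseteq> carrier G" "\<And>g. p g \<in> supported A'" "\<And>g. g \<notin> S \<Longrightarrow> p g = 0"
      "\<And>g. g \<in> carrier G \<Longrightarrow> Poly_Mapping.lookup w0 (k, g) = 0"
      "w = w0 + (\<Sum>g\<in>S. translate G g (p g))" "N w0 + (\<Sum>g\<in>S. Q (p g)) \<le> r" for w r w0 p S
    unfolding free_cost_def using that by blast
  \<comment> \<open>The index set of a decomposition may be enlarged, which aligns two decompositions.\<close>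
  have R_E: thesis
    if R: "?R w r" and T: "finite T" "T \<subseteq> carrier G"
      and *: "\<And>w0 p S. \<lbrakk>finite S; S \<subseteq> carrier G; T \<subseteq> S; \<And>g. p g \<in> supported A'; \<And>g. g \<notin> S \<Longrightarrow> p g = 0;
      \<And>g. g \<in> carrier G \<Longrightarrow> Poly_Mapping.lookup w0 (k, g) = 0; w = w0 + (\<Sum>g\<in>S. translate G g (p g));
      N w0 + (\<Sum>g\<in>S. Q (p g)) \<le> r\<rbrakk> \<Longrightarrow> thesis" for w r T thesis
    using R unfolding free_cost_def
  proof (elim exE conjE)
    fix w0 p S
    assume S: "finite S" "S \<subseteq> carrier G" and p: "\<forall>g. p g \<in> supported A'" "\<forall>g. g \<notin> S \<longrightarrow> p g = 0"
      and w0: "\<forall>g\<in>carrier G. Poly_Mapping.lookup w0 (k, g) = 0"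
      and w: "w = w0 + (\<Sum>g\<in>S. translate G g (p g))" and r: "N w0 + (\<Sum>g\<in>S. Q (p g)) \<le> r"
    have "(\<Sum>g\<in>S. translate G g (p g)) = (\<Sum>g\<in>S \<union> T. translate G g (p g))"
      "(\<Sum>g\<in>S. Q (p g)) = (\<Sum>g\<in>S \<union> T. Q (p g))"
      using S T p by (auto intro!: sum.mono_neutral_left simp: seminorm_zero[OF Q])
    then show thesis using S T p w0 w r by (intro *[of "S \<union> T" p w0]) auto
  qed
  have nonneg: "0 \<le> r" if R: "?R w r" for w r
  proof -
    obtain w0 p and S :: "'a set" where "N w0 + (\<Sum>g\<in>S. Q (p g)) \<le> r"
      using R unfolding free_cost_def by blast
    moreover have "0 \<le> N w0" "0 \<le> (\<Sum>g\<in>S. Q (p g))"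
      by (simp_all add: sum_nonneg seminorm_nonneg[OF Q])
    ultimately show ?thesis by linarith
  qed
  have tot: "\<exists>r. ?R w r" for w
  proof -
    define S where "S = {g \<in> carrier G. (k, g) \<in> Poly_Mapping.keys w}"
    define p where "p = (\<lambda>g. if g \<in> S then Poly_Mapping.lookup w (k, g) *\<^sub>R unit_vec (k, \<one>) else 0)"
    define w0 where "w0 = w - (\<Sum>g\<in>S. translate G g (p g))"
    have "finite ((\<lambda>g. (k, g)) -` Poly_Mapping.keys w)" by (intro finite_vimageI) (auto simp: inj_def)
    then have fin: "finite S" by (rule rev_finite_subset) (auto simp: S_def)
    have pA: "p g \<in> supported A'" for g by (simp add: p_def A'_def supported_scale)
    have p0: "p g = 0" if "g \<notin> S" for g using that by (simp add: p_def)
    have SG: "S \<subseteq> carrier G" by (auto simp: S_def)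
    have w00: "Poly_Mapping.lookup w0 (k, g) = 0" if "g \<in> carrier G" for g
    proof -
      have "Poly_Mapping.lookup (p g) (k, \<one>) = Poly_Mapping.lookup w (k, g)"
        using that by (auto simp: p_def S_def lookup_unit_vec in_keys_iff)
      then show ?thesis
        using lookup_sum_translates[OF fin SG pA[unfolded A'_def] p0 A that]
        by (simp add: w0_def lookup_minus)
    qed
    have w: "w = w0 + (\<Sum>g\<in>S. translate G g (p g))" by (simp add: w0_def)
    show ?thesis by (rule exI, rule R_I[OF fin SG _ _ _ w order_refl]; fact pA p0 w00)
  qed
  have semi: "seminorm (\<lambda>w. Inf {r. ?R w r})"
  proof (rule seminorm_Inf_cost[OF tot nonneg])
    fix x y r s assume x: "?R x r" and y: "?R y s"
    obtain w0 p S where 1: "finite S" "S \<subseteq> carrier G" "\<And>g. p g \<in> supported A'" "\<And>g. g \<notin> S \<Longrightarrow> p g = 0"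
      "\<And>g. g \<in> carrier G \<Longrightarrow> Poly_Mapping.lookup w0 (k, g) = 0"
      "x = w0 + (\<Sum>g\<in>S. translate G g (p g))" "N w0 + (\<Sum>g\<in>S. Q (p g)) \<le> r"
      by (rule R_E[OF x, of "{}"]) auto
    obtain w1 q T where 2: "finite T" "T \<subseteq> carrier G" "S \<subseteq> T" "\<And>g. q g \<in> supported A'" "\<And>g. g \<notin> T \<Longrightarrow> q g = 0"
      "\<And>g. g \<in> carrier G \<Longrightarrow> Poly_Mapping.lookup w1 (k, g) = 0"
      "y = w1 + (\<Sum>g\<in>T. translate G g (q g))" "N w1 + (\<Sum>g\<in>T. Q (q g)) \<le> s"
      by (rule R_E[OF y, of S]) (use 1 in auto)
    have S: "(\<Sum>g\<in>S. translate G g (p g)) = (\<Sum>g\<in>T. translate G g (p g))"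
      "(\<Sum>g\<in>S. Q (p g)) = (\<Sum>g\<in>T. Q (p g))"
      using 1 2 by (auto intro!: sum.mono_neutral_left simp: seminorm_zero[OF Q])
    have pT: "p g = 0" if "g \<notin> T" for g using 1(4) 2(3) that by blast
    show "?R (x + y) (r + s)"
    proof (rule R_I[of T "\<lambda>g. p g + q g" "w0 + w1"])
      show "x + y = w0 + w1 + (\<Sum>g\<in>T. translate G g (p g + q g))"
        using 1 2 S by (simp add: translate_add sum.distrib)
      have "(\<Sum>g\<in>T. Q (p g + q g)) \<le> (\<Sum>g\<in>T. Q (p g)) + (\<Sum>g\<in>T. Q (q g))"
        unfolding sum.distrib[symmetric] by (intro sum_mono seminorm_add[OF Q])
      then show "N (w0 + w1) + (\<Sum>g\<in>T. Q (p g + q g)) \<le> r + s"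
        using seminorm_add[OF N, of w0 w1] 1 2 S by linarith
    qed (use 1(3,5) 2 pT in \<open>auto simp: lookup_add supported_add\<close>)
  next
    fix x r and c :: real assume x: "?R x r"
    obtain w0 p S where 1: "finite S" "S \<subseteq> carrier G" "\<And>g. p g \<in> supported A'" "\<And>g. g \<notin> S \<Longrightarrow> p g = 0"
      "\<And>g. g \<in> carrier G \<Longrightarrow> Poly_Mapping.lookup w0 (k, g) = 0"
      "x = w0 + (\<Sum>g\<in>S. translate G g (p g))" "N w0 + (\<Sum>g\<in>S. Q (p g)) \<le> r"
      by (rule R_E[OF x, of "{}"]) auto
    show "?R (c *\<^sub>R x) (\<bar>c\<bar> * r)"
    proof (rule R_I[of S "\<lambda>g. c *\<^sub>R p g" "c *\<^sub>R w0"])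
      show "N (c *\<^sub>R w0) + (\<Sum>g\<in>S. Q (c *\<^sub>R p g)) \<le> \<bar>c\<bar> * r"
        using mult_left_mono[OF 1(7), of "\<bar>c\<bar>"]
        by (simp add: seminorm_scale[OF N] seminorm_scale[OF Q] algebra_simps sum_distrib_left)
    qed (use 1 in \<open>auto simp: supported_scale translate_scale scaleR_add_right scaleR_sum_right\<close>)
  qed
  define N' where "N' = (\<lambda>w. Inf {r. ?R w r})"
  have le: "N' w \<le> r" if "?R w r" for w r
    unfolding N'_def using nonneg that by (rule Inf_cost_le)
  have ge: "b \<le> N' w" if "\<And>r. ?R w r \<Longrightarrow> b \<le> r" for w b
    unfolding N'_def using nonneg tot that by (rule Inf_cost_ge)
  have coeff: "Poly_Mapping.lookup w (k, h) = Poly_Mapping.lookup (p h) (k, \<one>)"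
    if "finite S" "S \<subseteq> carrier G" "\<And>g. p g \<in> supported A'" "\<And>g. g \<notin> S \<Longrightarrow> p g = 0"
      "\<And>g. g \<in> carrier G \<Longrightarrow> Poly_Mapping.lookup w0 (k, g) = 0"
      "w = w0 + (\<Sum>g\<in>S. translate G g (p g))" "h \<in> carrier G" for w w0 p S h
    using lookup_sum_translates[OF that(1,2) that(3)[unfolded A'_def] that(4) A that(7)] that(5)[OF that(7)]
    by (simp add: that(6) lookup_add)
  have drop: "v \<in> supported A" if "v \<in> supported A'" "Poly_Mapping.lookup v (k, \<one>) = 0" for v
    using that by (auto simp: supported_def A'_def in_keys_iff)
  have NQ: "N v \<le> Q v" if "v \<in> supported A" for v
    using close[OF that] that kA by (simp add: Q_def a'_def lin_fun_upd_supported)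
  show ?thesis
  proof (rule that[of N'])
    have "N' (translate G h v) \<le> N' v" if h: "h \<in> carrier G" for h v
    proof (rule ge)
      fix r assume "?R v r"
      then obtain w0 p S where 1: "finite S" "S \<subseteq> carrier G" "\<And>g. p g \<in> supported A'" "\<And>g. g \<notin> S \<Longrightarrow> p g = 0"
        "\<And>g. g \<in> carrier G \<Longrightarrow> Poly_Mapping.lookup w0 (k, g) = 0"
        "v = w0 + (\<Sum>g\<in>S. translate G g (p g))" "N w0 + (\<Sum>g\<in>S. Q (p g)) \<le> r"
        by (rule R_E[of _ _ "{}"]) auto
      \<comment> \<open>Translating by \<open>h\<close> moves the piece at \<open>g\<close> to \<open>h \<otimes> g\<close>.\<close>
      define q where "q = (\<lambda>g. if g \<in> (\<otimes>) h ` S then p (inv h \<otimes> g) else 0)"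
      have inj: "inj_on ((\<otimes>) h) S"
        using 1(2) h by (auto simp: inj_on_def subset_iff)
      have q: "q (h \<otimes> g) = p g" if "g \<in> S" for g
        using that 1(2) h by (auto simp: q_def m_assoc[symmetric])
      have "?R (translate G h v) r"
      proof (rule R_I[of "(\<otimes>) h ` S" q "translate G h w0"])
        show "translate G h v = translate G h w0 + (\<Sum>g\<in>(\<otimes>) h ` S. translate G g (q g))"
          using 1 h by (auto simp: sum.reindex[OF inj] q translate_add translate_sum translate_translate
              intro!: sum.cong)
        show "N (translate G h w0) + (\<Sum>g\<in>(\<otimes>) h ` S. Q (q g)) \<le> r"
          using 1 h by (simp add: sum.reindex[OF inj] q inv)
      qed (use 1 h in \<open>auto simp: q_def lookup_translate shift_def\<close>)
      then show "N' (translate G h v) \<le> r" by (rule le)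
    qed
    note trans_le = this
    have "N' (translate G g v) = N' v" if g: "g \<in> carrier G" for g v
    proof -
      have "N' (translate G (inv g) (translate G g v)) \<le> N' (translate G g v)"
        using g by (intro trans_le) auto
      then show ?thesis using trans_le[OF g, of v] g by (simp add: translate_translate)
    qed
    moreover have "N' (unit_vec i) = 0" if i: "i \<notin> gens G (Suc k)" for i
    proof -
    have "?R (unit_vec i) 0"
    proof (rule R_I[of "{}" "\<lambda>_. 0" "unit_vec i"])
      have "i \<notin> gens G k" using i by (auto simp: gens_def)
      then show "N (unit_vec i) + (\<Sum>g\<in>{}. Q 0) \<le> 0" using vanish[of i] by simp
    qed (use i in \<open>auto simp: lookup_unit_vec gens_def\<close>)
    then show ?thesis by (intro antisym le ge nonneg)
    qed
    ultimately show "invariant_seminorm (Suc k) N'"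
      using semi by (auto simp: invariant_seminorm_def N'_def)
  next
    fix v assume v: "v \<in> supported (gens G k)"
    have v0: "Poly_Mapping.lookup v (k, g) = 0" for g
      using v by (rule lookup_eq_0_if_supported) (simp add: gens_def)
    have "?R v (N v)" by (rule R_I[of "{}" "\<lambda>_. 0" v]) (auto simp: v0)
    moreover have "N v \<le> r" if R: "?R v r" for r
    proof -
      obtain w0 p S where 1: "finite S" "S \<subseteq> carrier G" "\<And>g. p g \<in> supported A'" "\<And>g. g \<notin> S \<Longrightarrow> p g = 0"
        "\<And>g. g \<in> carrier G \<Longrightarrow> Poly_Mapping.lookup w0 (k, g) = 0"
        "v = w0 + (\<Sum>g\<in>S. translate G g (p g))" "N w0 + (\<Sum>g\<in>S. Q (p g)) \<le> r"
        by (rule R_E[OF R, of "{}"]) auto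
      have "N (translate G g (p g)) \<le> Q (p g)" if "g \<in> S" for g
        using that 1(2,3) coeff[OF 1(1-6)] v0 by (simp add: inv NQ drop subsetD)
      then have "N (\<Sum>g\<in>S. translate G g (p g)) \<le> (\<Sum>g\<in>S. Q (p g))"
        by (intro order_trans[OF seminorm_sum[OF N]] sum_mono)
      then show ?thesis using 1 seminorm_add[OF N, of w0 "\<Sum>g\<in>S. translate G g (p g)"] by simp
    qed
    ultimately show "N' v = N v" by (intro antisym le ge)
  next
    fix v assume "v \<in> supported (insert (k, \<one>) A)"
    then have v: "v \<in> supported A'" by (simp add: A'_def)
    have v0: "Poly_Mapping.lookup v (k, g) = 0" if "g \<noteq> \<one>" for g
      using v by (rule lookup_eq_0_if_supported) (use that A in \<open>auto simp: A'_def gens_def\<close>)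
    have "?R v (Q v)"
      by (rule R_I[of "{\<one>}" "\<lambda>g. if g = \<one> then v else 0" 0]) (auto simp: v)
    then have up: "N' v \<le> Q v" by (rule le)
    have low: "norm (lin a' v) - \<epsilon> * norm v \<le> N' v"
    proof (rule ge)
      fix r assume "?R v r"
      then obtain w0 p S where 1: "finite S" "S \<subseteq> carrier G" "\<And>g. p g \<in> supported A'" "\<And>g. g \<notin> S \<Longrightarrow> p g = 0"
        "\<And>g. g \<in> carrier G \<Longrightarrow> Poly_Mapping.lookup w0 (k, g) = 0"
        "v = w0 + (\<Sum>g\<in>S. translate G g (p g))" "N w0 + (\<Sum>g\<in>S. Q (p g)) \<le> r"
        and S1: "{\<one>} \<subseteq> S"
        by (rule R_E[of _ _ "{\<one>}"]) auto
      let ?T = "S - {\<one>}" and ?q = "v - p \<one>"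
      have spl: "(\<Sum>g\<in>S. translate G g (p g)) = p \<one> + (\<Sum>g\<in>?T. translate G g (p g))"
        "(\<Sum>g\<in>S. Q (p g)) = Q (p \<one>) + (\<Sum>g\<in>?T. Q (p g))"
        using S1 1(1) by (auto simp: sum.remove[of S "\<one>"])
      have "N (translate G g (p g)) \<le> Q (p g)" if "g \<in> ?T" for g
        using that 1(2,3) coeff[OF 1(1-6), of g] v0[of g] by (simp add: inv NQ drop subsetD)
      then have "N (\<Sum>g\<in>?T. translate G g (p g)) \<le> (\<Sum>g\<in>?T. Q (p g))"
        by (intro order_trans[OF seminorm_sum[OF N]] sum_mono)
      moreover have "?q = w0 + (\<Sum>g\<in>?T. translate G g (p g))" using 1(6) spl by simp
      ultimately have "N ?q + Q (p \<one>) \<le> r"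
        using seminorm_add[OF N, of w0 "\<Sum>g\<in>?T. translate G g (p g)"] 1(7) spl by simp
      moreover have "?q \<in> supported A"
        using coeff[OF 1(1-6), of "\<one>"] 1(3) v by (intro drop supported_diff) (auto simp: lookup_minus)
      then have "norm (lin a' ?q) - \<epsilon> * norm ?q \<le> N ?q"
        using close[of ?q] kA by (simp add: a'_def lin_fun_upd_supported)
      moreover have "norm (lin a' v) \<le> norm (lin a' ?q) + norm (lin a' (p \<one>))"
        using norm_triangle_ineq[of "lin a' ?q" "lin a' (p \<one>)"] by (simp add: lin_diff)
      moreover have "\<epsilon> * norm ?q \<le> \<epsilon> * norm v + \<epsilon> * norm (p \<one>)"
        using mult_left_mono[OF norm_triangle_ineq4[of v "p \<one>"] \<epsilon>] by (simp add: algebra_simps)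
      ultimately show "norm (lin a' v) - \<epsilon> * norm v \<le> r" by (simp add: Q_def)
    qed
    show "\<bar>N' v - norm (lin (a((k, \<one>) := z)) v)\<bar> \<le> \<epsilon> * norm v"
      using up low by (simp add: Q_def a'_def abs_le_iff)
  qed
qed

end

section \<open>Realizing an invariant seminorm in the Gurarij space\<close>

lemma dyadic_increments_converge:
  fixes x :: "nat \<Rightarrow> 'v::banach"
  assumes "\<And>p. n \<le> p \<Longrightarrow> norm (x (Suc p) - x p) \<le> c / 2 ^ p"
  shows "convergent x" and "norm (lim x - x n) \<le> 2 * c / 2 ^ n"
proof -
  have tele: "norm (x (p + q) - x p) \<le> 2 * c / 2 ^ p - 2 * c / 2 ^ (p + q)" if "n \<le> p" for p q
  proof (induction q)
    case (Suc q)
    have "norm (x (p + Suc q) - x p) \<le> norm (x (Suc (p + q)) - x (p + q)) + norm (x (p + q) - x p)"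
      using norm_triangle_ineq[of "x (Suc (p + q)) - x (p + q)" "x (p + q) - x p"] by simp
    also have "\<dots> \<le> c / 2 ^ (p + q) + (2 * c / 2 ^ p - 2 * c / 2 ^ (p + q))"
      using Suc assms[of "p + q"] that by simp
    finally show ?case by (simp add: field_simps)
  qed simp
  have "0 \<le> c / 2 ^ n" using order_trans[OF norm_ge_zero assms[of n]] by simp
  then have "0 \<le> c / 2 ^ n * 2 ^ n" by (rule mult_nonneg_nonneg) simp
  then have c: "0 \<le> c" by simp
  have tele': "norm (x q - x p) \<le> 2 * c / 2 ^ p" if "n \<le> p" "p \<le> q" for p q
  proof -
    have "0 \<le> 2 * c / 2 ^ (p + (q - p))" using c by simp
    then show ?thesis using tele[OF that(1), of "q - p"] that(2) by simp
  qed
  have "(\<lambda>p. 2 * c * (1 / 2) ^ p) \<longlonglongrightarrow> 2 * c * 0"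
    by (intro tendsto_intros LIMSEQ_realpow_zero) auto
  then have small: "(\<lambda>p. 2 * c / 2 ^ p) \<longlonglongrightarrow> 0" by (simp add: power_divide)
  have "Cauchy x"
  proof (rule CauchyI')
    fix e :: real assume "0 < e"
    from order_tendstoD(2)[OF small this] obtain m where m: "\<And>p. m \<le> p \<Longrightarrow> 2 * c / 2 ^ p < e"
      by (auto simp: eventually_sequentially)
    show "\<exists>M. \<forall>p\<ge>M. \<forall>q>p. dist (x p) (x q) < e"
    proof (intro exI[of _ "max m n"] allI impI)
      fix p q assume "max m n \<le> p" "p < q"
      then show "dist (x p) (x q) < e" using tele'[of p q] m[of p] by (simp add: dist_norm norm_minus_commute)
    qed
  qed
  then show conv: "convergent x" by (simp add: Cauchy_convergent_iff)
  have "(\<lambda>q. norm (x q - x n)) \<longlonglongrightarrow> norm (lim x - x n)"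
    using conv by (intro tendsto_intros) (simp add: convergent_LIMSEQ_iff)
  then show "norm (lim x - x n) \<le> 2 * c / 2 ^ n"
    by (rule LIMSEQ_le_const2) (auto intro!: exI[of _ n] tele')
qed

text \<open>
  In the back-and-forth construction the \<open>n\<close>-th point is approximated with an error depending on
  \<open>n\<close>, so dense range needs a sequence that comes back to every ball after every stage.
\<close>

lemma recurrent_dense_sequence:
  assumes "separable_space (euclidean :: 'v::metric_space topology)"
  obtains d :: "nat \<Rightarrow> 'v::metric_space" where "\<forall>z e m. 0 < e \<longrightarrow> (\<exists>n\<ge>m. dist (d n) z < e)"
proof -
  obtain C :: "'v set" where C: "countable C" "closure C = UNIV"
    using assms by (auto simp: separable_space_def euclidean_closure_of)
  then have ne: "C \<noteq> {}" by auto
  show ?thesis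
  proof (rule that[of "\<lambda>n. from_nat_into C (fst (prod_decode n))"], intro allI impI)
    fix z :: 'v and e :: real and m :: nat assume "0 < e"
    then obtain c where c: "c \<in> C" "dist c z < e"
      using C(2) closure_approachable[of z C] by auto
    then obtain j where j: "from_nat_into C j = c" using C(1) ne by (metis from_nat_into_surj)
    have "m \<le> prod_encode (j, m)" by (rule le_prod_encode_2)
    then show "\<exists>n\<ge>m. dist (from_nat_into C (fst (prod_decode n))) z < e"
      using c j by (intro exI[of _ "prod_encode (j, m)"]) simp
  qed
qed

context group
begin

text \<open>
  Stage \<open>n\<close> consists of an invariant seminorm on the first \<open>m + n\<close> generators, a finite set of basis
  vectors, and their images with accuracy \<open>\<epsilon> / 2 ^ n\<close>.  The next stage adjoins a generator over
  the \<open>n\<close>-th point of a dense sequence and then improves the images.  The seminorms extend one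
  another, so passing to the limit of the images gives an isometric map on the whole free module,
  and the adjoined generators make its range dense.
\<close>

lemma realize_invariant_seminorm:
  fixes a :: "nat \<times> 'a \<Rightarrow> 'g::banach"
  assumes Gur: "gurarij_space TYPE('g)" and "countable (carrier G)"
    and N: "invariant_seminorm m N" and A: "finite A" "A \<subseteq> gens G m" and \<epsilon>: "0 < \<epsilon>"
    and close: "\<And>v. v \<in> supported A \<Longrightarrow> \<bar>N v - norm (lin a v)\<bar> \<le> \<epsilon> * norm v"
  obtains b :: "nat \<times> 'a \<Rightarrow> 'g" where
    "\<And>g v. g \<in> carrier G \<Longrightarrow> v \<in> supported (UNIV \<times> carrier G) \<Longrightarrow>
       norm (lin b (translate G g v)) = norm (lin b v)"
    "closure (lin b ` supported (UNIV \<times> carrier G)) = UNIV"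
    "\<And>v. v \<in> supported (gens G m) \<Longrightarrow> norm (lin b v) = N v"
    "\<And>i. i \<in> A \<Longrightarrow> norm (b i - a i) \<le> 4 * \<epsilon>"
proof -
  obtain d :: "nat \<Rightarrow> 'g" where d: "\<forall>z e m. 0 < e \<longrightarrow> (\<exists>n\<ge>m. dist (d n) z < e)"
    by (rule recurrent_dense_sequence[OF Gur[unfolded gurarij_space_def, THEN conjunct1]])
  define e where "e = from_nat_into (carrier G)"
  have e: "e l \<in> carrier G" for l unfolding e_def using from_nat_into[of "carrier G"] by auto
  have e_surj: "\<exists>l. e l = g" if "g \<in> carrier G" for g
    unfolding e_def using from_nat_into_surj[OF \<open>countable (carrier G)\<close> that] by blast
  \<comment> \<open>Finite sets of basis vectors that exhaust the free module.\<close>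
  define B where "B = (\<lambda>n. {..<m + n} \<times> e ` {..<n})"
  have B: "finite (B n)" "B n \<subseteq> gens G (m + n)" for n using e by (auto simp: B_def gens_def)
  \<comment> \<open>The invariant of a stage; its last clause fixes the initial stage.\<close>
  define P where "P = (\<lambda>n (N', A', a'). invariant_seminorm (m + n) N' \<and> finite A' \<and> A' \<subseteq> gens G (m + n) \<and>
      (\<forall>v\<in>supported A'. \<bar>N' v - norm (lin a' v)\<bar> \<le> \<epsilon> / 2 ^ n * norm v) \<and>
      (n = 0 \<longrightarrow> (N', A', a') = (N, A, a)))"
  define Q where "Q = (\<lambda>n (N' :: _ \<Rightarrow> real, A', a' :: nat \<times> 'a \<Rightarrow> 'g) (N'', A'', a'').
      (\<forall>v\<in>supported (gens G (m + n)). N'' v = N' v) \<and> A' \<subseteq> A'' \<and> B n \<subseteq> A'' \<and>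
      (\<forall>i\<in>A'. norm (a'' i - a' i) \<le> 2 * \<epsilon> / 2 ^ n) \<and>
      (m + n, \<one>) \<in> A'' \<and> norm (a'' (m + n, \<one>) - d n) \<le> 2 * \<epsilon> / 2 ^ n)"
  have "\<exists>s. \<forall>n. P n (s n) \<and> Q n (s n) (s (Suc n))"
  proof (rule dependent_nat_choice)
    have "P 0 (N, A, a)" using N A close by (simp add: P_def)
    then show "\<exists>x. P 0 x" ..
  next
    fix x n assume "P n x"
    then obtain N' A' a' where x: "x = (N', A', a')" and N': "invariant_seminorm (m + n) N'"
      and A': "finite A'" "A' \<subseteq> gens G (m + n)"
      and close': "\<And>v. v \<in> supported A' \<Longrightarrow> \<bar>N' v - norm (lin a' v)\<bar> \<le> \<epsilon> / 2 ^ n * norm v"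
      by (cases x) (auto simp: P_def)
    have pos: "0 < \<epsilon> / 2 ^ n" "0 < \<epsilon> / 2 ^ Suc n" using \<epsilon> by simp_all
    obtain N1 where N1: "invariant_seminorm (Suc (m + n)) N1"
      "\<And>v. v \<in> supported (gens G (m + n)) \<Longrightarrow> N1 v = N' v"
      "\<And>v. v \<in> supported (insert (m + n, \<one>) A') \<Longrightarrow>
         \<bar>N1 v - norm (lin (a'((m + n, \<one>) := d n)) v)\<bar> \<le> \<epsilon> / 2 ^ n * norm v"
      using adjoin_generator[OF N' less_imp_le[OF pos(1)] A'(2) close', of "d n"] by blast
    have semi: "seminorm N1" using N1(1) by (simp add: invariant_seminorm_def)
    let ?A1 = "insert (m + n, \<one>) A'" and ?a1 = "a'((m + n, \<one>) := d n)"
    let ?A2 = "?A1 \<union> B n"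
    have fin: "finite ?A2" using A' B by simp
    obtain a2 where a2: "\<And>i. i \<in> ?A1 \<Longrightarrow> norm (a2 i - ?a1 i) \<le> 2 * (\<epsilon> / 2 ^ n)"
      "\<And>v. v \<in> supported ?A2 \<Longrightarrow> \<bar>N1 v - norm (lin a2 v)\<bar> \<le> \<epsilon> / 2 ^ Suc n * norm v"
      using improve_realization[OF Gur semi pos fin Un_upper1 N1(3)] by blast
    have new: "(m + n, \<one>) \<notin> A'" using A'(2) by (auto simp: gens_def)
    have "?A2 \<subseteq> gens G (m + Suc n)"
      using A'(2) B(2)[of n] by (auto simp: gens_def)
    then have "P (Suc n) (N1, ?A2, a2)"
      using N1(1) a2(2) fin by (auto simp: P_def)
    moreover have "Q n x (N1, ?A2, a2)"
    proof -
      have "norm (a2 i - a' i) \<le> 2 * \<epsilon> / 2 ^ n" if "i \<in> A'" for i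
        using a2(1)[of i] that new by (auto split: if_splits)
      moreover have "norm (a2 (m + n, \<one>) - d n) \<le> 2 * \<epsilon> / 2 ^ n"
        using a2(1)[of "(m + n, \<one>)"] by simp
      ultimately show ?thesis using N1(2) by (auto simp: Q_def x)
    qed
    ultimately show "\<exists>y. P (Suc n) y \<and> Q n x y" by blast
  qed
  then obtain s where s: "\<And>n. P n (s n)" "\<And>n. Q n (s n) (s (Suc n))" by blast
  define fN fA fa where "fN = (\<lambda>n. fst (s n))" and "fA = (\<lambda>n. fst (snd (s n)))" and "fa = (\<lambda>n. snd (snd (s n)))"
  have s_eq: "s n = (fN n, fA n, fa n)" for n by (simp add: fN_def fA_def fa_def)
  have init: "fN 0 = N" "fA 0 = A" "fa 0 = a"
    using s(1)[of 0] unfolding s_eq by (auto simp: P_def)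
  have inv: "fN n (translate G g v) = fN n v" if "g \<in> carrier G" for n g v
    using s(1)[of n] that unfolding s_eq by (auto simp: P_def invariant_seminorm_def)
  have close_n: "\<bar>fN n v - norm (lin (fa n) v)\<bar> \<le> \<epsilon> / 2 ^ n * norm v" if "v \<in> supported (fA n)" for n v
    using s(1)[of n] that unfolding s_eq by (auto simp: P_def)
  have extends: "fN (Suc n) v = fN n v" if "v \<in> supported (gens G (m + n))" for n v
    using s(2)[of n] that unfolding s_eq by (auto simp: Q_def)
  have step: "fA n \<subseteq> fA (Suc n)" "B n \<subseteq> fA (Suc n)" "(m + n, \<one>) \<in> fA (Suc n)"
    "norm (fa (Suc n) (m + n, \<one>) - d n) \<le> 2 * \<epsilon> / 2 ^ n"
    "\<And>i. i \<in> fA n \<Longrightarrow> norm (fa (Suc n) i - fa n i) \<le> 2 * \<epsilon> / 2 ^ n" for n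
    using s(2)[of n] unfolding s_eq by (auto simp: Q_def)
  have mono: "fA n \<subseteq> fA p" if "n \<le> p" for n p
    using that step(1) by (rule lift_Suc_mono_le[rotated])
  have fN_stable: "fN p v = fN n v" if "v \<in> supported (gens G (m + n))" "n \<le> p" for n p v
    using that(2)
  proof (induction p rule: dec_induct)
    case (step p)
    have "gens G (m + n) \<subseteq> gens G (m + p)" using step by (auto simp: gens_def)
    then show ?case using extends[of v p] step that(1) supported_mono by fastforce
  qed simp
  define b where "b = (\<lambda>i. lim (\<lambda>n. fa n i))"
  have inc: "norm (fa (Suc p) i - fa p i) \<le> 2 * \<epsilon> / 2 ^ p" if "i \<in> fA n" "n \<le> p" for i n p
    using step(5)[of i p] mono[OF that(2)] that(1) by blast
  have b_lim: "(\<lambda>n. fa n i) \<longlonglongrightarrow> b i" and b_near: "norm (b i - fa n i) \<le> 4 * \<epsilon> / 2 ^ n"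
    if "i \<in> fA n" for i n
    using dyadic_increments_converge[of n "\<lambda>n. fa n i" "2 * \<epsilon>"] inc[OF that]
    by (auto simp: b_def convergent_LIMSEQ_iff)
  have eventually_in: "\<exists>n. i \<in> fA n" if i: "i \<in> UNIV \<times> carrier G" for i
  proof -
    obtain j g where jg: "i = (j, g)" "g \<in> carrier G" using i by auto
    obtain l where "e l = g" using e_surj[OF jg(2)] by blast
    then have "i \<in> B (Suc (max j l))" by (auto simp: jg B_def)
    then show ?thesis using step(2) by blast
  qed
  have norm_b: "norm (lin b v) = fN n v" if v: "v \<in> supported (gens G (m + n))" for n v
  proof -
    have keys: "i \<in> UNIV \<times> carrier G" if "i \<in> Poly_Mapping.keys v" for i
      using v that by (auto simp: supported_def gens_def)
    have "(\<lambda>p. norm (lin (fa p) v)) \<longlonglongrightarrow> norm (lin b v)"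
      unfolding lin_def using b_lim eventually_in[OF keys] by (intro tendsto_intros) blast
    moreover have "(\<lambda>p. fN n v - norm (lin (fa p) v)) \<longlonglongrightarrow> 0"
    proof (rule Lim_null_comparison)
      have "\<forall>\<^sub>F p in sequentially. i \<in> fA p" if "i \<in> Poly_Mapping.keys v" for i
        using eventually_in[OF keys[OF that]] mono unfolding eventually_sequentially by blast
      then have "\<forall>\<^sub>F p in sequentially. \<forall>i\<in>Poly_Mapping.keys v. i \<in> fA p"
        by (intro eventually_ball_finite) auto
      then show "\<forall>\<^sub>F p in sequentially. norm (fN n v - norm (lin (fa p) v)) \<le> \<epsilon> * norm v * (1 / 2) ^ p"
        using eventually_ge_at_top[of n]
      proof eventually_elim
        case (elim p)
        then show ?case using close_n[of v p] fN_stable[OF v, of p]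
          by (auto simp: supported_def power_divide)
      qed
      have "(\<lambda>p. \<epsilon> * norm v * (1 / 2) ^ p) \<longlonglongrightarrow> \<epsilon> * norm v * 0"
        by (intro tendsto_intros LIMSEQ_realpow_zero) auto
      then show "(\<lambda>p. \<epsilon> * norm v * (1 / 2) ^ p) \<longlonglongrightarrow> 0" by simp
    qed
    from tendsto_diff[OF tendsto_const[of "fN n v"] this]
    have "(\<lambda>p. norm (lin (fa p) v)) \<longlonglongrightarrow> fN n v" by simp
    ultimately show ?thesis by (rule LIMSEQ_unique)
  qed
  show ?thesis
  proof (rule that[of b])
    fix g and v :: "nat \<times> 'a \<Rightarrow>\<^sub>0 real"
    assume g: "g \<in> carrier G" and v: "v \<in> supported (UNIV \<times> carrier G)"
    define n where "n = Suc (Max (insert 0 (fst ` Poly_Mapping.keys v)))"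
    have "fst i < m + n" if "i \<in> Poly_Mapping.keys v" for i
    proof -
      have "fst i \<le> Max (insert 0 (fst ` Poly_Mapping.keys v))" using that by (intro Max_ge) auto
      then show ?thesis by (simp add: n_def)
    qed
    then have vn: "v \<in> supported (gens G (m + n))"
      using v by (force simp: supported_def gens_def)
    then have "translate G g v \<in> supported (gens G (m + n))"
      unfolding gens_def by (rule translate_supported[OF g])
    then show "norm (lin b (translate G g v)) = norm (lin b v)"
      using norm_b vn inv[OF g] by metis
  next
    have "z \<in> closure (lin b ` supported (UNIV \<times> carrier G))" for z
    proof (rule closure_approachable[THEN iffD2], intro allI impI)
      fix r :: real assume r: "0 < r"
      have "(\<lambda>n. 4 * \<epsilon> * (1 / 2) ^ n) \<longlonglongrightarrow> 4 * \<epsilon> * 0"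
        by (intro tendsto_intros LIMSEQ_realpow_zero) auto
      then have "(\<lambda>n. 4 * \<epsilon> / 2 ^ n) \<longlonglongrightarrow> 0" by (simp add: power_divide)
      then have "\<forall>\<^sub>F n in sequentially. 4 * \<epsilon> / 2 ^ n < r / 2"
        by (rule order_tendstoD(2)) (use r in simp)
      then obtain p where p: "\<And>n. p \<le> n \<Longrightarrow> 4 * \<epsilon> / 2 ^ n < r / 2"
        unfolding eventually_sequentially by blast
      obtain n where n: "p \<le> n" "dist (d n) z < r / 2" using d r half_gt_zero by blast
      have "norm (b (m + n, \<one>) - d n) \<le>
          norm (b (m + n, \<one>) - fa (Suc n) (m + n, \<one>)) + norm (fa (Suc n) (m + n, \<one>) - d n)"
        by norm
      also have "\<dots> \<le> 4 * \<epsilon> / 2 ^ Suc n + 2 * \<epsilon> / 2 ^ n"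
        by (intro add_mono b_near step(3,4))
      also have "\<dots> = 4 * \<epsilon> / 2 ^ n" by (simp add: field_simps)
      finally have "dist (b (m + n, \<one>)) (d n) < r / 2" using p[OF n(1)] by (simp add: dist_norm)
      then have "dist (b (m + n, \<one>)) z < r" using n(2) dist_triangle[of "b (m + n, \<one>)" z "d n"] by simp
      then show "\<exists>y\<in>lin b ` supported (UNIV \<times> carrier G). dist y z < r"
        by (intro bexI[of _ "lin b (unit_vec (m + n, \<one>))"] imageI) auto
    qed
    then show "closure (lin b ` supported (UNIV \<times> carrier G)) = UNIV" by auto
  next
    fix v assume "v \<in> supported (gens G m)"
    then show "norm (lin b v) = N v" using norm_b[of v 0] init by simp
  next
    fix i assume "i \<in> A"
    then show "norm (b i - a i) \<le> 4 * \<epsilon>" using b_near[of i 0] init by simp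
  qed
qed

end

section \<open>Representations near a given one\<close>

lemma dense_isometry_extension:
  fixes L R :: "'v::real_vector \<Rightarrow> 'g::banach"
  assumes "linear L" "linear R" and V: "subspace V"
    and iso: "\<And>v. v \<in> V \<Longrightarrow> norm (R v) = norm (L v)" and dense: "closure (L ` V) = UNIV"
  obtains T where "linear T" "\<And>x. norm (T x) = norm x" "\<And>v. v \<in> V \<Longrightarrow> T (L v) = R v"
proof -
  define g where "g = (\<lambda>w. R (inv_into V L w))"
  have diff: "norm (R v - R w) = norm (L v - L w)" if "v \<in> V" "w \<in> V" for v w
    using iso[OF subspace_diff[OF V that]] by (simp add: linear_diff assms(1,2))
  have g: "g (L v) = R v" if "v \<in> V" for v
  proof -
    have "inv_into V L (L v) \<in> V" "L (inv_into V L (L v)) = L v"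
      using that by (auto intro: inv_into_into f_inv_into_f)
    then show ?thesis using diff[of "inv_into V L (L v)" v] that by (simp add: g_def)
  qed
  have "uniformly_continuous_on (L ` V) g"
    unfolding uniformly_continuous_on_def dist_norm by (auto simp: g diff)
  then obtain T where T: "uniformly_continuous_on (closure (L ` V)) T" "\<And>x. x \<in> L ` V \<Longrightarrow> g x = T x"
    by (rule uniformly_continuous_on_extension_on_closure) blast
  have TL: "T (L v) = R v" if "v \<in> V" for v using T(2)[of "L v"] g that by simp
  have cont: "(\<lambda>n. T (x n)) \<longlonglongrightarrow> T l" if "x \<longlonglongrightarrow> l" for x l
    using uniformly_continuous_imp_continuous[OF T(1)] that unfolding dense
    by (auto simp: continuous_on_eq_continuous_at intro: isCont_tendsto_compose)
  have approx: "\<exists>v. (\<forall>n. v n \<in> V) \<and> (\<lambda>n. L (v n)) \<longlonglongrightarrow> x" for x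
  proof -
    obtain w where w: "\<And>n. w n \<in> L ` V" "w \<longlonglongrightarrow> x"
      using dense closure_sequential[of x "L ` V"] by auto
    then have "\<forall>n. \<exists>v. v \<in> V \<and> w n = L v" by blast
    then obtain v where v: "\<And>n. v n \<in> V" "\<And>n. w n = L (v n)" by metis
    then have "w = (\<lambda>n. L (v n))" by auto
    then show ?thesis using v w by blast
  qed
  show ?thesis
  proof (rule that[OF _ _ TL])
    show "linear T"
    proof (rule linearI)
      fix x y
      obtain v w where v: "\<And>n. v n \<in> V" "(\<lambda>n. L (v n)) \<longlonglongrightarrow> x"
        and w: "\<And>n. w n \<in> V" "(\<lambda>n. L (w n)) \<longlonglongrightarrow> y" using approx by metis
      have "(\<lambda>n. T (L (v n) + L (w n))) \<longlonglongrightarrow> T (x + y)" by (intro cont tendsto_add v w)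
      moreover have "T (L (v n) + L (w n)) = T (L (v n)) + T (L (w n))" for n
        using TL[OF subspace_add[OF V v(1) w(1)], of n n]
        by (simp add: linear_add assms(1,2) TL v w)
      ultimately have "(\<lambda>n. T (L (v n)) + T (L (w n))) \<longlonglongrightarrow> T (x + y)" by simp
      moreover have "(\<lambda>n. T (L (v n)) + T (L (w n))) \<longlonglongrightarrow> T x + T y"
        by (intro cont tendsto_add v w)
      ultimately show "T (x + y) = T x + T y" by (rule LIMSEQ_unique)
    next
      fix c x
      obtain v where v: "\<And>n. v n \<in> V" "(\<lambda>n. L (v n)) \<longlonglongrightarrow> x" using approx by metis
      have "(\<lambda>n. T (c *\<^sub>R L (v n))) \<longlonglongrightarrow> T (c *\<^sub>R x)" by (intro cont tendsto_intros v)
      moreover have "T (c *\<^sub>R L (v n)) = c *\<^sub>R T (L (v n))" for n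
        using TL[OF subspace_scale[OF V v(1)], of c n]
        by (simp add: linear_scale assms(1,2) TL v)
      ultimately have "(\<lambda>n. c *\<^sub>R T (L (v n))) \<longlonglongrightarrow> T (c *\<^sub>R x)" by simp
      moreover have "(\<lambda>n. c *\<^sub>R T (L (v n))) \<longlonglongrightarrow> c *\<^sub>R T x"
        by (intro cont tendsto_intros v)
      ultimately show "T (c *\<^sub>R x) = c *\<^sub>R T x" by (rule LIMSEQ_unique)
    qed
  next
    fix x
    obtain v where v: "\<And>n. v n \<in> V" "(\<lambda>n. L (v n)) \<longlonglongrightarrow> x" using approx by metis
    have "(\<lambda>n. norm (T (L (v n)))) \<longlonglongrightarrow> norm (T x)" by (intro cont tendsto_norm v)
    then have "(\<lambda>n. norm (L (v n))) \<longlonglongrightarrow> norm (T x)" by (simp add: TL v iso)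
    moreover have "(\<lambda>n. norm (L (v n))) \<longlonglongrightarrow> norm x" by (intro tendsto_norm v)
    ultimately show "norm (T x) = norm x" by (rule LIMSEQ_unique)
  qed
qed

lemma isometry_continuous:
  assumes "linear T" "\<And>x. norm (T x) = norm x"
  shows "continuous_on UNIV T"
  using assms by (intro linear_continuous_on bounded_linear_intro[of T 1]) (auto simp: linear_add linear_scale)

lemma isometries_eq_on_dense:
  fixes S T :: "'v::real_normed_vector \<Rightarrow> 'w::real_normed_vector"
  assumes "linear S" "\<And>x. norm (S x) = norm x" "linear T" "\<And>x. norm (T x) = norm x"
    and "closure D = UNIV" "\<And>x. x \<in> D \<Longrightarrow> S x = T x"
  shows "S = T"
proof
  fix x
  have "closed {x. S x = T x}"
    using assms by (intro closed_Collect_eq isometry_continuous)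
  then have "closure D \<subseteq> {x. S x = T x}" using assms(6) by (intro closure_minimal) auto
  then show "S x = T x" using assms(5) by auto
qed

lemma
  assumes "\<pi> \<in> Rep G" "g \<in> carrier G"
  shows Rep_linear: "linear (\<pi> g)" and Rep_isometry: "norm (\<pi> g x) = norm x"
    and Rep_mult: "h \<in> carrier G \<Longrightarrow> \<pi> (g \<otimes>\<^bsub>G\<^esub> h) x = \<pi> g (\<pi> h x)"
  using assms by (auto simp: Rep_def hom_def LIso_def)

context group
begin

lemma Rep_one:
  assumes "\<pi> \<in> Rep G" shows "\<pi> \<one> x = x"
proof -
  have "\<pi> \<one> (\<pi> \<one> x - x) = 0"
    using Rep_mult[OF assms one_closed one_closed, of x]
    by (simp add: linear_diff Rep_linear[OF assms])
  then have "norm (\<pi> \<one> x - x) = 0" by (metis Rep_isometry[OF assms one_closed] norm_zero)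
  then show ?thesis by simp
qed

text \<open>
  Each translation preserves the norm pulled back along \<open>lin b\<close>, so it descends to the range of
  \<open>lin b\<close> and extends to the closure.  The extensions compose like the translations because
  isometries are determined on a dense set; surjectivity comes from the inverse group element.
\<close>

lemma Rep_of_invariant_norm:
  fixes b :: "nat \<times> 'a \<Rightarrow> 'g::banach"
  assumes iso: "\<And>g v. g \<in> carrier G \<Longrightarrow> v \<in> supported (UNIV \<times> carrier G) \<Longrightarrow>
       norm (lin b (translate G g v)) = norm (lin b v)"
    and dense: "closure (lin b ` supported (UNIV \<times> carrier G)) = UNIV"
  shows "\<exists>\<rho>\<in>Rep G. \<forall>g\<in>carrier G. \<forall>v\<in>supported (UNIV \<times> carrier G). \<rho> g (lin b v) = lin b (translate G g v)"
proof -
  let ?V = "supported (UNIV \<times> carrier G)"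
  have "\<exists>T. linear T \<and> (\<forall>x. norm (T x) = norm x) \<and> (\<forall>v\<in>?V. T (lin b v) = lin b (translate G g v))"
    if g: "g \<in> carrier G" for g
    by (rule dense_isometry_extension[OF linear_lin _ subspace_supported iso[OF g] dense])
      (use linear_compose[OF linear_translate[of G g] linear_lin[of b]] in \<open>auto simp: o_def\<close>)
  then obtain T where T: "\<And>g. g \<in> carrier G \<Longrightarrow> linear (T g)" "\<And>g x. g \<in> carrier G \<Longrightarrow> norm (T g x) = norm x"
    "\<And>g v. g \<in> carrier G \<Longrightarrow> v \<in> ?V \<Longrightarrow> T g (lin b v) = lin b (translate G g v)"
    by metis
  have comp: "T (g \<otimes> h) = T g \<circ> T h" if "g \<in> carrier G" "h \<in> carrier G" for g h
  proof (rule isometries_eq_on_dense[OF _ _ _ _ dense])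
    fix x assume "x \<in> lin b ` ?V"
    then show "T (g \<otimes> h) x = (T g \<circ> T h) x"
      using that by (auto simp: T translate_supported translate_translate)
  qed (use that in \<open>auto simp: T intro!: linear_compose\<close>)
  have one: "T \<one> = id"
    by (rule isometries_eq_on_dense[OF _ _ _ _ dense]) (auto simp: T linear_id)
  have "T g \<in> carrier LIso" if "g \<in> carrier G" for g
  proof -
    have "T g (T (inv g) x) = x" for x
      using comp[of g "inv g"] one that by (simp add: fun_eq_iff)
    then have "surj (T g)" by (metis surjI)
    then show ?thesis using that by (simp add: LIso_def T)
  qed
  then have "restrict T (carrier G) \<in> Rep G"
    using comp by (auto simp: Rep_def hom_def LIso_def)
  then show ?thesis by (rule bexI[rotated]) (auto simp: T)
qed

text \<open>
  A family \<open>\<Psi>\<close> is read as a linear map that sends \<open>x\<close> to the function \<open>g \<mapsto> \<Psi> g x\<close>, with the sup norm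
  and the action of the group by right translation.  The hypotheses say that this map is isometric
  and, on \<open>X\<close>, equivariant for \<open>F\<close> up to \<open>\<delta>\<close>.  Then the action on the functions can be copied to a
  representation \<open>\<rho>\<close> on the Gurarij space that is close to \<open>\<pi>\<close> and displaces the vectors of \<open>X\<close>
  as much as the model displaces their images, up to a multiple of \<open>\<delta>\<close>.
\<close>

lemma Rep_near_model:
  fixes \<pi> :: "'a \<Rightarrow> 'g::banach \<Rightarrow> 'g" and \<Psi> :: "'a \<Rightarrow> 'g \<Rightarrow> 'g"
  assumes Gur: "gurarij_space TYPE('g)" and count: "countable (carrier G)"
    and \<pi>: "\<pi> \<in> Rep G" and F: "finite F" "F \<subseteq> carrier G" and X: "finite X" and \<delta>: "0 < \<delta>"
    and lin_\<Psi>: "\<And>g. g \<in> carrier G \<Longrightarrow> linear (\<Psi> g)"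
    and \<Psi>_le: "\<And>g x. g \<in> carrier G \<Longrightarrow> norm (\<Psi> g x) \<le> norm x"
    and \<Psi>_one: "\<And>x. norm (\<Psi> \<one> x) = norm x"
    and equiv: "\<And>g f x. g \<in> carrier G \<Longrightarrow> f \<in> F \<Longrightarrow> x \<in> X \<Longrightarrow> norm (\<Psi> (g \<otimes> f) x - \<Psi> g (\<pi> f x)) \<le> \<delta>"
  obtains \<rho> where "\<rho> \<in> Rep G"
    "\<forall>f\<in>F. \<forall>x\<in>X. norm (\<rho> f x - \<pi> f x) \<le> 8 * \<delta>"
    "\<forall>h\<in>carrier G. \<forall>x\<in>X. norm (\<Psi> h x - \<Psi> \<one> x) - 8 * \<delta> \<le> norm (\<rho> h x - x)"
    "\<forall>h\<in>carrier G. \<forall>x\<in>X. \<forall>c. (\<forall>g\<in>carrier G. norm (\<Psi> (g \<otimes> h) x - \<Psi> g x) \<le> c) \<longrightarrow>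
       norm (\<rho> h x - x) \<le> c + 8 * \<delta>"
proof -
  obtain xs where xs: "set xs = X" using finite_list[OF X] by blast
  define m where "m = length xs"
  define C where "C = (\<Sum>x\<in>X. norm x)"
  have C: "norm (xs ! i) \<le> C" if "i < m" for i
    unfolding C_def using that X xs by (intro member_le_sum) (auto simp: m_def)
  have C0: "0 \<le> C" by (simp add: C_def sum_nonneg)
  \<comment> \<open>The free module maps equivariantly to the functions; \<open>N\<close> is the sup norm pulled back.\<close>
  define \<beta> where "\<beta> = (\<lambda>g i. if i \<in> gens G m then \<Psi> (g \<otimes> snd i) (xs ! fst i) else 0)"
  define N where "N = (\<lambda>v. SUP g\<in>carrier G. norm (lin (\<beta> g) v))"
  have ne: "carrier G \<noteq> {}" by blast
  have \<beta>_le: "norm (\<beta> g i) \<le> C" if "g \<in> carrier G" for g i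
    using that C0 by (auto simp: \<beta>_def gens_def intro: order_trans[OF \<Psi>_le C])
  have "norm (lin (\<beta> g) v) \<le> C * norm v" if "g \<in> carrier G" for g v
    using that by (intro seminorm_lin_le[OF seminorm_norm] \<beta>_le)
  then have bdd: "bdd_above ((\<lambda>g. norm (lin (\<beta> g) v)) ` carrier G)" for v by (intro bdd_aboveI2)
  have N_upper: "norm (lin (\<beta> g) v) \<le> N v" if "g \<in> carrier G" for g v
    unfolding N_def using that bdd by (rule cSUP_upper)
  have N_least: "N v \<le> c" if "\<And>g. g \<in> carrier G \<Longrightarrow> norm (lin (\<beta> g) v) \<le> c" for v c
    unfolding N_def using ne that by (rule cSUP_least)
  have "seminorm (\<lambda>v. norm (lin (\<beta> g) v))" for g
    by (simp add: seminorm_def lin_add lin_scale norm_triangle_ineq)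
  then have semi: "seminorm N" unfolding N_def using ne bdd by (intro seminorm_SUP)
  have inv_N: "N (translate G h v) = N v" if h: "h \<in> carrier G" for h v
  proof -
    have \<beta>: "lin (\<beta> g) (translate G h v) = lin (\<beta> (g \<otimes> h)) v" if "g \<in> carrier G" for g
      unfolding lin_translate using that h
      by (intro lin_cong) (auto simp: \<beta>_def shift_def gens_def m_assoc)
    show ?thesis
    proof (intro antisym N_least)
      fix g assume g: "g \<in> carrier G"
      show "norm (lin (\<beta> g) (translate G h v)) \<le> N v" using g h by (simp add: \<beta> N_upper)
      have "lin (\<beta> g) v = lin (\<beta> (g \<otimes> inv h)) (translate G h v)"
        using g h by (simp add: \<beta> m_assoc)
      then show "norm (lin (\<beta> g) v) \<le> N (translate G h v)" using g h by (simp add: N_upper)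
    qed
  qed
  have "N (unit_vec i) = 0" if "i \<notin> gens G m" for i
    using that ne by (simp add: N_def \<beta>_def)
  with semi inv_N have invN: "invariant_seminorm m N" by (simp add: invariant_seminorm_def)
  note \<pi>_LIso = Rep_linear[OF \<pi>] Rep_isometry[OF \<pi>]
  have \<pi>_one: "\<pi> \<one> x = x" for x by (simp add: Rep_one[OF \<pi>])
  \<comment> \<open>The basis vector \<open>(j, f)\<close> should go to \<open>\<pi> f (xs ! j)\<close>, as almost equivariance suggests.\<close>
  define A where "A = {..<m} \<times> insert \<one> F"
  define a where "a = (\<lambda>i. \<pi> (snd i) (xs ! fst i))"
  have A: "finite A" "A \<subseteq> gens G m" using F by (auto simp: A_def gens_def)
  have close: "\<bar>N v - norm (lin a v)\<bar> \<le> \<delta> * norm v" if v: "v \<in> supported A" for v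
  proof -
    have near: "norm (lin (\<beta> g) v - \<Psi> g (lin a v)) \<le> \<delta> * norm v" if g: "g \<in> carrier G" for g
    proof -
      have "lin (\<beta> g) v - \<Psi> g (lin a v) = lin (\<lambda>i. \<beta> g i - \<Psi> g (a i)) v"
        unfolding linear_apply_lin[OF lin_\<Psi>[OF g]]
        by (simp add: lin_def scaleR_diff_right sum_subtractf)
      also have "norm \<dots> \<le> \<delta> * norm v"
      proof (rule seminorm_lin_le[OF seminorm_norm])
        fix i assume "i \<in> Poly_Mapping.keys v"
        then have "i \<in> A" using v by (auto simp: supported_def)
        then obtain j f where i: "i = (j, f)" "j < m" "f = \<one> \<or> f \<in> F" by (auto simp: A_def)
        have "xs ! j \<in> X" using i xs by (auto simp: m_def)
        then show "norm (\<beta> g i - \<Psi> g (a i)) \<le> \<delta>"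
          using i g F \<delta> equiv[OF g, of f "xs ! j"] by (auto simp: \<beta>_def a_def gens_def \<pi>_one)
      qed
      finally show ?thesis .
    qed
    have "N v \<le> norm (lin a v) + \<delta> * norm v"
    proof (rule N_least)
      fix g assume g: "g \<in> carrier G"
      show "norm (lin (\<beta> g) v) \<le> norm (lin a v) + \<delta> * norm v"
        using near[OF g] \<Psi>_le[OF g, of "lin a v"] norm_triangle_sub[of "lin (\<beta> g) v" "\<Psi> g (lin a v)"] by linarith
    qed
    moreover have "norm (lin a v) - \<delta> * norm v \<le> N v"
      using near[OF one_closed] N_upper[OF one_closed, of v] \<Psi>_one[of "lin a v"]
        norm_triangle_sub[of "\<Psi> \<one> (lin a v)" "lin (\<beta> \<one>) v"] by (simp add: norm_minus_commute)
    ultimately show ?thesis by (simp add: abs_le_iff)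
  qed
  obtain b where b: "\<And>g v. g \<in> carrier G \<Longrightarrow> v \<in> supported (UNIV \<times> carrier G) \<Longrightarrow>
       norm (lin b (translate G g v)) = norm (lin b v)"
    "closure (lin b ` supported (UNIV \<times> carrier G)) = UNIV"
    "\<And>v. v \<in> supported (gens G m) \<Longrightarrow> norm (lin b v) = N v"
    "\<And>i. i \<in> A \<Longrightarrow> norm (b i - a i) \<le> 4 * \<delta>"
    by (rule realize_invariant_seminorm[OF Gur count invN A \<delta>, of a], erule close, (rule that; blast))
  obtain \<rho> where \<rho>: "\<rho> \<in> Rep G"
    "\<forall>g\<in>carrier G. \<forall>v\<in>supported (UNIV \<times> carrier G). \<rho> g (lin b v) = lin b (translate G g v)"
    using Rep_of_invariant_norm[OF b(1,2)] by blast
  note \<rho>_LIso = Rep_linear[OF \<rho>(1)] Rep_isometry[OF \<rho>(1)]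
  have \<rho>_gen: "\<rho> g (b (j, \<one>)) = b (j, g)" if "g \<in> carrier G" for g j
    using \<rho>(2)[rule_format, OF that, of "unit_vec (j, \<one>)"] that by (simp add: shift_def)
  have near_x: "norm (b (j, \<one>) - xs ! j) \<le> 4 * \<delta>" if "j < m" for j
    using b(4)[of "(j, \<one>)"] that by (simp add: A_def a_def \<pi>_one)
  have \<rho>_near: "norm (\<rho> g (xs ! j) - b (j, g)) \<le> 4 * \<delta>" if "g \<in> carrier G" "j < m" for g j
  proof -
    have "\<rho> g (xs ! j) - b (j, g) = \<rho> g (xs ! j - b (j, \<one>))"
      using that by (simp add: linear_diff \<rho>_LIso(1) \<rho>_gen)
    then show ?thesis using near_x[OF that(2)] that by (simp add: \<rho>_LIso(2) norm_minus_commute)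
  qed
  have displacement: "\<bar>norm (\<rho> h (xs ! j) - xs ! j) - N (unit_vec (j, h) - unit_vec (j, \<one>))\<bar> \<le> 8 * \<delta>"
    if "h \<in> carrier G" "j < m" for h j
  proof -
    have "unit_vec (j, h) - unit_vec (j, \<one>) \<in> supported (gens G m)"
      using that by (intro supported_diff) (auto simp: gens_def)
    from b(3)[OF this] have "N (unit_vec (j, h) - unit_vec (j, \<one>)) = norm (b (j, h) - b (j, \<one>))"
      by (simp add: lin_diff)
    moreover have "norm (\<rho> h (xs ! j) - xs ! j) - norm (b (j, h) - b (j, \<one>))
        \<le> norm (\<rho> h (xs ! j) - b (j, h)) + norm (b (j, \<one>) - xs ! j)" by norm
    moreover have "norm (b (j, h) - b (j, \<one>)) - norm (\<rho> h (xs ! j) - xs ! j)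
        \<le> norm (\<rho> h (xs ! j) - b (j, h)) + norm (b (j, \<one>) - xs ! j)" by norm
    ultimately show ?thesis using \<rho>_near[OF that] near_x[OF that(2)] by simp
  qed
  have \<beta>_gens: "lin (\<beta> g) (unit_vec (j, h) - unit_vec (j, \<one>)) = \<Psi> (g \<otimes> h) (xs ! j) - \<Psi> g (xs ! j)"
    if "g \<in> carrier G" "h \<in> carrier G" "j < m" for g h j
    using that by (simp add: lin_diff \<beta>_def gens_def)
  show ?thesis
  proof (rule that[OF \<rho>(1)]; intro ballI allI impI)
    fix f x assume f: "f \<in> F" and "x \<in> X"
    then obtain j where j: "j < m" "x = xs ! j" using xs by (metis in_set_conv_nth m_def)
    have "norm (b (j, f) - \<pi> f x) \<le> 4 * \<delta>" using b(4)[of "(j, f)"] f j by (simp add: A_def a_def)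
    then show "norm (\<rho> f x - \<pi> f x) \<le> 8 * \<delta>"
      using \<rho>_near[of f j] F f j norm_triangle_ineq[of "\<rho> f x - b (j, f)" "b (j, f) - \<pi> f x"] by auto
  next
    fix h x assume h: "h \<in> carrier G" and "x \<in> X"
    then obtain j where j: "j < m" "x = xs ! j" using xs by (metis in_set_conv_nth m_def)
    have "norm (\<Psi> h x - \<Psi> \<one> x) \<le> N (unit_vec (j, h) - unit_vec (j, \<one>))"
      using N_upper[OF one_closed, of "unit_vec (j, h) - unit_vec (j, \<one>)"] \<beta>_gens[OF one_closed h j(1)] h j by simp
    then show "norm (\<Psi> h x - \<Psi> \<one> x) - 8 * \<delta> \<le> norm (\<rho> h x - x)"
      using displacement[OF h j(1)] j by simp
  next
    fix h x c assume h: "h \<in> carrier G" and "x \<in> X"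
      and c: "\<forall>g\<in>carrier G. norm (\<Psi> (g \<otimes> h) x - \<Psi> g x) \<le> c"
    then obtain j where j: "j < m" "x = xs ! j" using xs by (metis in_set_conv_nth m_def)
    have "N (unit_vec (j, h) - unit_vec (j, \<one>)) \<le> c"
      by (rule N_least) (use c j h in \<open>simp add: \<beta>_gens\<close>)
    then show "norm (\<rho> h x - x) \<le> c + 8 * \<delta>"
      using displacement[OF h j(1)] j by simp
  qed
qed

end

section \<open>Large and small displacements near any representation\<close>

context group
begin

text \<open>
  Take the sets \<open>W j\<close> of words of length at most \<open>j\<close> in \<open>F\<close> and their inverses, and let \<open>u g\<close> be the
  proportion of \<open>j < n\<close> with \<open>g \<in> W j\<close>.  Multiplication by an element of \<open>F\<close> shifts \<open>j\<close> by at most one,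
  so \<open>u\<close> changes by at most \<open>1 / n\<close>.
\<close>

lemma slowly_varying_cutoff:
  assumes F: "finite F" "F \<subseteq> carrier G" and \<eta>: "0 < \<eta>"
  obtains u :: "'a \<Rightarrow> real" where "\<forall>g. 0 \<le> u g \<and> u g \<le> 1" "u \<one> = 1" "finite {g \<in> carrier G. u g \<noteq> 0}"
    "\<forall>g\<in>carrier G. \<forall>f\<in>F. \<bar>u (g \<otimes> f) - u g\<bar> \<le> \<eta>"
proof -
  define W where "W = rec_nat {\<one>} (\<lambda>_ S. S \<union> (\<Union>f\<in>F. (\<lambda>g. g \<otimes> f) ` S \<union> (\<lambda>g. g \<otimes> inv f) ` S))"
  have W_0: "W 0 = {\<one>}"
    and W_Suc: "W (Suc j) = W j \<union> (\<Union>f\<in>F. (\<lambda>g. g \<otimes> f) ` W j \<union> (\<lambda>g. g \<otimes> inv f) ` W j)" for j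
    by (simp_all add: W_def)
  have finW: "finite (W j)" for j by (induction j) (auto simp: W_0 W_Suc F)
  have one: "\<one> \<in> W j" for j by (induction j) (auto simp: W_0 W_Suc)
  have right: "g \<otimes> f \<in> W (Suc j)" if "g \<in> W j" "f \<in> F" for g f j using that by (auto simp: W_Suc)
  have left: "g \<in> W (Suc j)" if "g \<otimes> f \<in> W j" "f \<in> F" "g \<in> carrier G" for g f j
  proof -
    have "g = g \<otimes> f \<otimes> inv f" using that F(2) by (auto simp: m_assoc)
    then show ?thesis using that by (auto simp: W_Suc)
  qed
  obtain n :: nat where n: "0 < n" "1 / real n < \<eta>"
    using ex_inverse_of_nat_less[OF \<eta>] by (auto simp: inverse_eq_divide)
  define J where "J = (\<lambda>g. {j. j < n \<and> g \<in> W j})"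
  define u where "u = (\<lambda>g. real (card (J g)) / real n)"
  have J: "finite (J g)" "J g \<subseteq> {..<n}" for g by (auto simp: J_def)
  have card_le: "card (J g) \<le> card (J h) + 1" if "\<And>j. g \<in> W j \<Longrightarrow> h \<in> W (Suc j)" for g h
  proof -
    have "Suc ` J g \<subseteq> insert n (J h)" using that by (auto simp: J_def)
    then have "card (Suc ` J g) \<le> card (insert n (J h))" using J by (intro card_mono) auto
    then show ?thesis using card_insert_le_m1[of "Suc (card (J h))" "J h" n] by (simp add: card_image)
  qed
  show ?thesis
  proof (rule that[of u])
    have "card (J g) \<le> n" for g using card_mono[OF _ J(2), of g] by simp
    then show "\<forall>g. 0 \<le> u g \<and> u g \<le> 1" using n by (simp add: u_def)
  next
    have "J \<one> = {..<n}" using one by (auto simp: J_def)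
    then show "u \<one> = 1" using n by (simp add: u_def)
  next
    have "{g \<in> carrier G. u g \<noteq> 0} \<subseteq> (\<Union>j<n. W j)"
    proof
      fix g assume "g \<in> {g \<in> carrier G. u g \<noteq> 0}"
      then have "J g \<noteq> {}" by (auto simp: u_def)
      then show "g \<in> (\<Union>j<n. W j)" by (auto simp: J_def)
    qed
    then show "finite {g \<in> carrier G. u g \<noteq> 0}" using finW by (auto intro: finite_subset)
  next
    show "\<forall>g\<in>carrier G. \<forall>f\<in>F. \<bar>u (g \<otimes> f) - u g\<bar> \<le> \<eta>"
    proof (intro ballI)
      fix g f assume g: "g \<in> carrier G" "f \<in> F"
      have "card (J (g \<otimes> f)) \<le> card (J g) + 1" "card (J g) \<le> card (J (g \<otimes> f)) + 1"
        by (rule card_le, erule left, fact+) (rule card_le, erule right, fact)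
      then have "\<bar>real (card (J (g \<otimes> f))) - real (card (J g))\<bar> \<le> 1" by linarith
      then have "\<bar>u (g \<otimes> f) - u g\<bar> \<le> 1 / real n"
        using n by (simp add: u_def abs_divide divide_right_mono flip: diff_divide_distrib)
      then show "\<bar>u (g \<otimes> f) - u g\<bar> \<le> \<eta>" using n by linarith
    qed
  qed
qed

text \<open>
  The models are \<open>\<Psi> s g x = u g *\<^sub>R \<pi> g x - s * u (inv h \<otimes> g) *\<^sub>R \<pi> (inv h \<otimes> g) x\<close>, with \<open>s = 0\<close> for
  the small and \<open>s = 1\<close> for the large displacement.  If \<open>h\<close> avoids all quotients of elements of the
  support of \<open>u\<close>, then the two terms never overlap, and neither do \<open>u\<close> and its right translate by
  \<open>h\<close>.  For \<open>s = 1\<close> the values of the function at \<open>\<one>\<close> and at \<open>h\<close> are \<open>y\<close> and \<open>- y\<close>.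
\<close>

lemma Rep_near_with_displacements:
  fixes \<pi> :: "'a \<Rightarrow> 'g::banach \<Rightarrow> 'g" and y :: 'g
  assumes Gur: "gurarij_space TYPE('g)" and count: "countable (carrier G)" and inf: "infinite (carrier G)"
    and \<pi>: "\<pi> \<in> Rep G" and F: "finite F" "F \<subseteq> carrier G" and X: "finite X" and \<delta>: "0 < \<delta>"
  obtains h \<rho> \<sigma> where "h \<in> carrier G" "\<rho> \<in> Rep G" "\<sigma> \<in> Rep G"
    "\<forall>f\<in>F. \<forall>x\<in>X. norm (\<rho> f x - \<pi> f x) \<le> \<delta>" "\<forall>f\<in>F. \<forall>x\<in>X. norm (\<sigma> f x - \<pi> f x) \<le> \<delta>"
    "2 * norm y - \<delta> \<le> norm (\<rho> h y - y)" "norm (\<sigma> h y - y) \<le> norm y + \<delta>"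
proof -
  define Y where "Y = insert y X"
  define C where "C = (\<Sum>x\<in>Y. norm x)"
  have Y: "finite Y" using X by (simp add: Y_def)
  have C: "norm x \<le> C" if "x \<in> Y" for x
    unfolding C_def using that Y by (intro member_le_sum) auto
  have C0: "0 \<le> C" by (simp add: C_def sum_nonneg)
  \<comment> \<open>Two cutoff terms, each off by \<open>\<eta> * C\<close>, must stay below \<open>\<delta> / 8\<close>.\<close>
  define \<eta> where "\<eta> = \<delta> / (16 * (C + 1))"
  have \<eta>: "0 < \<eta>" using \<delta> C0 by (simp add: \<eta>_def)
  have \<eta>C: "2 * (\<eta> * C) \<le> \<delta> / 8"
  proof -
    have "16 * (\<eta> * (C + 1)) = \<delta>" using C0 by (simp add: \<eta>_def field_simps)
    then show ?thesis using \<eta> by (simp add: algebra_simps)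
  qed
  obtain u :: "'a \<Rightarrow> real" where u01: "\<forall>g. 0 \<le> u g \<and> u g \<le> 1" and u1: "u \<one> = 1"
    and fin: "finite {g \<in> carrier G. u g \<noteq> 0}"
    and var: "\<forall>g\<in>carrier G. \<forall>f\<in>F. \<bar>u (g \<otimes> f) - u g\<bar> \<le> \<eta>"
    by (rule slowly_varying_cutoff[OF F \<eta>])
  have u: "0 \<le> u g" "u g \<le> 1" for g using u01 by auto
  define B where "B = {g \<in> carrier G. u g \<noteq> 0}"
  \<comment> \<open>The first set separates the two terms of \<open>\<Psi> 1\<close>; the second separates \<open>u\<close> from its translate.\<close>
  define E where "E = (\<lambda>(p, q). p \<otimes> inv q) ` (B \<times> B) \<union> (\<lambda>(p, q). inv p \<otimes> q) ` (B \<times> B)"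
  have "finite E" using fin by (simp add: E_def B_def)
  then have "infinite (carrier G - E)" using inf by (rule Diff_infinite_finite)
  then have "carrier G - E \<noteq> {}" by (metis finite.emptyI)
  then obtain h where h: "h \<in> carrier G" "h \<notin> E" by blast
  have disj_left: "u g = 0 \<or> u (inv h \<otimes> g) = 0" if g: "g \<in> carrier G" for g
  proof (rule ccontr)
    assume "\<not> ?thesis"
    then have "g \<in> B" "inv h \<otimes> g \<in> B" using g h(1) by (simp_all add: B_def)
    then have "g \<otimes> inv (inv h \<otimes> g) \<in> E" unfolding E_def by (intro UnI1 image_eqI[of _ _ "(g, inv h \<otimes> g)"]) auto
    moreover have "g \<otimes> inv (inv h \<otimes> g) = h"
      using g h(1) by (simp add: inv_mult_group m_assoc[symmetric])
    ultimately show False using h(2) by simp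
  qed
  have disj_right: "u g = 0 \<or> u (g \<otimes> h) = 0" if g: "g \<in> carrier G" for g
  proof (rule ccontr)
    assume "\<not> ?thesis"
    then have "g \<in> B" "g \<otimes> h \<in> B" using g h(1) by (simp_all add: B_def)
    then have "inv g \<otimes> (g \<otimes> h) \<in> E" unfolding E_def by (intro UnI2 image_eqI[of _ _ "(g, g \<otimes> h)"]) auto
    moreover have "inv g \<otimes> (g \<otimes> h) = h" using g h(1) by (simp add: m_assoc[symmetric])
    ultimately show False using h(2) by simp
  qed
  have uh: "u h = 0" "u (inv h) = 0"
    using disj_right[of \<one>] disj_left[of \<one>] h(1) u1 by auto
  note \<pi>_lin = Rep_linear[OF \<pi>] and \<pi>_iso = Rep_isometry[OF \<pi>] and \<pi>_mult = Rep_mult[OF \<pi>]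
  have u_le: "norm (u k *\<^sub>R \<pi> g x) \<le> norm x" if "g \<in> carrier G" for k g x
    using that u(1,2)[of k] by (simp add: \<pi>_iso mult_left_le_one_le)
  have u_var: "norm ((u (g \<otimes> f) - u g) *\<^sub>R \<pi> k x) \<le> \<eta> * C"
    if "g \<in> carrier G" "f \<in> F" "k \<in> carrier G" "x \<in> Y" for g f k x
    using that var C \<eta> by (auto simp: \<pi>_iso intro!: mult_mono)
  define \<Psi> where "\<Psi> = (\<lambda>s g x. u g *\<^sub>R \<pi> g x - (s * u (inv h \<otimes> g)) *\<^sub>R \<pi> (inv h \<otimes> g) x)"
  have model: "\<exists>\<rho>. \<rho> \<in> Rep G \<and> (\<forall>f\<in>F. \<forall>x\<in>Y. norm (\<rho> f x - \<pi> f x) \<le> \<delta>) \<and>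
      norm (\<Psi> s h y - \<Psi> s \<one> y) - \<delta> \<le> norm (\<rho> h y - y) \<and>
      (\<forall>c. (\<forall>g\<in>carrier G. norm (\<Psi> s (g \<otimes> h) y - \<Psi> s g y) \<le> c) \<longrightarrow> norm (\<rho> h y - y) \<le> c + \<delta>)"
    if s: "s = 0 \<or> s = 1" for s
  proof -
    have lin_\<Psi>: "linear (\<Psi> s g)" if "g \<in> carrier G" for g
      unfolding \<Psi>_def using that h(1) by (intro linear_compose_sub linear_compose_scale_right \<pi>_lin) auto
    have \<Psi>_le: "norm (\<Psi> s g x) \<le> norm x" if g: "g \<in> carrier G" for g x
      using disj_left[OF g] s u_le[of g g x] u_le[of "inv h \<otimes> g" "inv h \<otimes> g" x] g h(1)
      by (auto simp: \<Psi>_def)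
    have \<Psi>_one: "norm (\<Psi> s \<one> x) = norm x" for x
      using h(1) uh u1 by (simp add: \<Psi>_def Rep_one[OF \<pi>])
    have equiv: "norm (\<Psi> s (g \<otimes> f) x - \<Psi> s g (\<pi> f x)) \<le> \<delta> / 8"
      if g: "g \<in> carrier G" and f: "f \<in> F" and x: "x \<in> Y" for g f x
    proof -
      have fG: "f \<in> carrier G" using f F(2) by blast
      define k where "k = inv h \<otimes> g"
      have k: "k \<in> carrier G" "inv h \<otimes> (g \<otimes> f) = k \<otimes> f" using g fG h(1) by (auto simp: k_def m_assoc)
      have "\<Psi> s (g \<otimes> f) x - \<Psi> s g (\<pi> f x) =
          (u (g \<otimes> f) - u g) *\<^sub>R \<pi> (g \<otimes> f) x - s *\<^sub>R ((u (k \<otimes> f) - u k) *\<^sub>R \<pi> (k \<otimes> f) x)"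
        using g fG k by (simp add: \<Psi>_def k_def[symmetric] \<pi>_mult algebra_simps)
      also have "norm \<dots> \<le> norm ((u (g \<otimes> f) - u g) *\<^sub>R \<pi> (g \<otimes> f) x) +
          \<bar>s\<bar> * norm ((u (k \<otimes> f) - u k) *\<^sub>R \<pi> (k \<otimes> f) x)"
        by (metis norm_scaleR norm_triangle_ineq4)
      also have "\<dots> \<le> \<eta> * C + 1 * (\<eta> * C)"
        using g fG k f x s \<eta> C0 by (intro add_mono mult_mono u_var) auto
      finally show ?thesis using \<eta>C by linarith
    qed
    have \<delta>8: "0 < \<delta> / 8" using \<delta> by simp
    obtain \<rho> where \<rho>: "\<rho> \<in> Rep G" "\<forall>f\<in>F. \<forall>x\<in>Y. norm (\<rho> f x - \<pi> f x) \<le> 8 * (\<delta> / 8)"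
      "\<forall>h\<in>carrier G. \<forall>x\<in>Y. norm (\<Psi> s h x - \<Psi> s \<one> x) - 8 * (\<delta> / 8) \<le> norm (\<rho> h x - x)"
      "\<forall>h\<in>carrier G. \<forall>x\<in>Y. \<forall>c. (\<forall>g\<in>carrier G. norm (\<Psi> s (g \<otimes> h) x - \<Psi> s g x) \<le> c) \<longrightarrow>
         norm (\<rho> h x - x) \<le> c + 8 * (\<delta> / 8)"
      using Rep_near_model[OF Gur count \<pi> F Y \<delta>8 lin_\<Psi> \<Psi>_le \<Psi>_one equiv] by blast
    have "y \<in> Y" by (simp add: Y_def)
    then show ?thesis
      using \<rho>(1,2) \<rho>(3,4)[rule_format, OF h(1), of y] by (intro exI[of _ \<rho>]) simp
  qed
  have far: "norm (\<Psi> 1 h y - \<Psi> 1 \<one> y) = 2 * norm y"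
  proof -
    have "\<Psi> 1 h y - \<Psi> 1 \<one> y = (- 2) *\<^sub>R y"
      using h(1) uh u1 by (simp add: \<Psi>_def Rep_one[OF \<pi>] scaleR_2)
    then show ?thesis by simp
  qed
  have near: "norm (\<Psi> 0 (g \<otimes> h) y - \<Psi> 0 g y) \<le> norm y" if g: "g \<in> carrier G" for g
    using disj_right[OF g] u_le[of g g y] u_le[of "g \<otimes> h" "g \<otimes> h" y] g h(1) by (auto simp: \<Psi>_def)
  from model[of 1] obtain \<rho> where "\<rho> \<in> Rep G" "\<forall>f\<in>F. \<forall>x\<in>Y. norm (\<rho> f x - \<pi> f x) \<le> \<delta>"
    "2 * norm y - \<delta> \<le> norm (\<rho> h y - y)" unfolding far by auto
  moreover from model[of 0] obtain \<sigma> where "\<sigma> \<in> Rep G" "\<forall>f\<in>F. \<forall>x\<in>Y. norm (\<sigma> f x - \<pi> f x) \<le> \<delta>"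
    "norm (\<sigma> h y - y) \<le> norm y + \<delta>" using near by auto
  ultimately show ?thesis using h(1) by (intro that[of h \<rho> \<sigma>]) (auto simp: Y_def)
qed

end

section \<open>Conjugacy classes are meager\<close>

lemma LIso_topology_neighbourhood:
  fixes T :: "'g::real_normed_vector \<Rightarrow> 'g"
  assumes "openin LIso_topology U" "T \<in> U"
  shows "\<exists>X \<delta>. finite X \<and> 0 < \<delta> \<and> (\<forall>S\<in>carrier LIso. (\<forall>x\<in>X. norm (S x - T x) < \<delta>) \<longrightarrow> S \<in> U)"
proof -
  obtain W where W: "openin (product_topology (\<lambda>_::'g. euclidean :: 'g topology) UNIV) W" "U = W \<inter> carrier LIso"
    using assms(1) by (auto simp: LIso_topology_def openin_subtopology)
  then obtain V where V: "finite {x. V x \<noteq> UNIV}" "\<And>x. open (V x)" "\<And>x. T x \<in> V x" "\<And>S. (\<And>x. S x \<in> V x) \<Longrightarrow> S \<in> W"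
    using assms(2) unfolding openin_product_topology_alt by (force simp: PiE_iff)
  have "\<forall>x. \<exists>r>0. \<forall>z. norm (z - T x) < r \<longrightarrow> z \<in> V x"
    using V(2,3) by (metis dist_norm open_dist)
  then obtain r where r: "\<And>x. 0 < r x" "\<And>x z. norm (z - T x) < r x \<Longrightarrow> z \<in> V x" by metis
  define X where "X = {x. V x \<noteq> UNIV}"
  define \<delta> where "\<delta> = Min (insert 1 (r ` X))"
  have X: "finite X" using V(1) by (simp add: X_def)
  have "0 < \<delta>" using X r(1) by (simp add: \<delta>_def)
  moreover have "S \<in> U" if "S \<in> carrier LIso" "\<forall>x\<in>X. norm (S x - T x) < \<delta>" for S
  proof -
    have "S x \<in> V x" for x
    proof (cases "x \<in> X")
      case True
      then have "\<delta> \<le> r x" unfolding \<delta>_def using X by (intro Min_le) auto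
      then show ?thesis using that(2) True by (intro r(2)) force
    qed (simp add: X_def)
    then show ?thesis using V(4) W(2) that(1) by blast
  qed
  ultimately show ?thesis using X by blast
qed

lemma Rep_topology_neighbourhood:
  fixes \<pi> :: "'a \<Rightarrow> 'g::real_normed_vector \<Rightarrow> 'g"
  assumes "openin (Rep_topology G) U" "\<pi> \<in> U"
  obtains F X \<delta> where "finite F" "F \<subseteq> carrier G" "finite X" "0 < \<delta>"
    "\<forall>\<rho>\<in>Rep G. (\<forall>f\<in>F. \<forall>x\<in>X. norm (\<rho> f x - \<pi> f x) < \<delta>) \<longrightarrow> \<rho> \<in> U"
proof -
  obtain W where W: "openin (product_topology (\<lambda>_. LIso_topology) (carrier G)) W" "U = W \<inter> Rep G"
    using assms(1) by (auto simp: Rep_topology_def openin_subtopology)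
  then obtain V where V: "finite {g \<in> carrier G. V g \<noteq> carrier LIso}"
    "\<And>g. g \<in> carrier G \<Longrightarrow> openin LIso_topology (V g)" "\<pi> \<in> PiE (carrier G) V" "PiE (carrier G) V \<subseteq> W"
    using assms(2) unfolding openin_product_topology_alt by force
  have "\<forall>g\<in>carrier G. \<exists>X \<delta>. finite X \<and> 0 < \<delta> \<and> (\<forall>S\<in>carrier LIso. (\<forall>x\<in>X. norm (S x - \<pi> g x) < \<delta>) \<longrightarrow> S \<in> V g)"
    using V(2,3) by (intro ballI LIso_topology_neighbourhood) auto
  then obtain X r where X: "\<And>g. g \<in> carrier G \<Longrightarrow> finite (X g)" and r: "\<And>g. g \<in> carrier G \<Longrightarrow> 0 < r g"
    and Xr: "\<And>g S. g \<in> carrier G \<Longrightarrow> S \<in> carrier LIso \<Longrightarrow> \<forall>x\<in>X g. norm (S x - \<pi> g x) < r g \<Longrightarrow> S \<in> V g"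
    by metis
  define F where "F = {g \<in> carrier G. V g \<noteq> carrier LIso}"
  define \<delta> where "\<delta> = Min (insert 1 (r ` F))"
  have F: "finite F" "F \<subseteq> carrier G" using V(1) by (auto simp: F_def)
  show ?thesis
  proof (rule that[OF F, of "\<Union>g\<in>F. X g" \<delta>])
    show "finite (\<Union>g\<in>F. X g)" using F X by auto
    show "0 < \<delta>" using F r by (auto simp: \<delta>_def)
    show "\<forall>\<rho>\<in>Rep G. (\<forall>f\<in>F. \<forall>x\<in>\<Union>g\<in>F. X g. norm (\<rho> f x - \<pi> f x) < \<delta>) \<longrightarrow> \<rho> \<in> U"
    proof (intro ballI impI)
      fix \<rho> :: "'a \<Rightarrow> 'g \<Rightarrow> 'g"
      assume \<rho>: "\<rho> \<in> Rep G" and near: "\<forall>f\<in>F. \<forall>x\<in>\<Union>g\<in>F. X g. norm (\<rho> f x - \<pi> f x) < \<delta>"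
      have \<rho>_LIso: "\<rho> g \<in> carrier LIso" if "g \<in> carrier G" for g using \<rho> that by (auto simp: Rep_def hom_def)
      have "\<rho> g \<in> V g" if g: "g \<in> carrier G" for g
      proof (cases "g \<in> F")
        case True
        then have "\<delta> \<le> r g" unfolding \<delta>_def using F by (intro Min_le) auto
        then show ?thesis using near True by (intro Xr g \<rho>_LIso) force
      qed (use g \<rho>_LIso in \<open>auto simp: F_def\<close>)
      moreover have "\<rho> \<in> extensional (carrier G)" using \<rho> by (simp add: Rep_def)
      ultimately have "\<rho> \<in> PiE (carrier G) V" by (simp add: PiE_iff)
      then show "\<rho> \<in> U" using V(4) W(2) \<rho> by blast
    qed
  qed
qed

lemma continuous_map_displacement:
  fixes y :: "'g::real_normed_vector"
  assumes "g \<in> carrier G"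
  shows "continuous_map (Rep_topology G) euclidean (\<lambda>\<pi>. norm (\<pi> g y - y))"
proof -
  have 1: "continuous_map (Rep_topology G) LIso_topology (\<lambda>\<pi>. \<pi> g)"
    unfolding Rep_topology_def
    by (rule continuous_map_from_subtopology[OF continuous_map_product_projection[OF assms]])
  have 2: "continuous_map LIso_topology euclidean (\<lambda>T :: 'g \<Rightarrow> 'g. T y)"
    unfolding LIso_topology_def
    by (rule continuous_map_from_subtopology[OF continuous_map_product_projection]) simp
  have 3: "continuous_map euclidean euclidean (\<lambda>z :: 'g. norm (z - y))"
    by (simp add: continuous_map_iff_continuous2) (intro continuous_intros)
  show ?thesis
    using continuous_map_compose[OF continuous_map_compose[OF 1 2] 3] by (simp add: o_def)
qed

lemma closedin_displacement_near:
  fixes y :: "'g::real_normed_vector"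
  assumes "carrier G \<noteq> {}"
  shows "closedin (Rep_topology G) {\<pi> \<in> Rep G. \<forall>g\<in>carrier G. \<bar>norm (\<pi> g y - y) - \<psi> g\<bar> \<le> c}"
proof -
  have "closedin (Rep_topology G) {\<pi> \<in> topspace (Rep_topology G). norm (\<pi> g y - y) \<in> {\<psi> g - c..\<psi> g + c}}"
    if "g \<in> carrier G" for g
    using that by (intro closedin_continuous_map_preimage[OF continuous_map_displacement]) auto
  then have "closedin (Rep_topology G)
      (\<Inter>g\<in>carrier G. {\<pi> \<in> topspace (Rep_topology G). norm (\<pi> g y - y) \<in> {\<psi> g - c..\<psi> g + c}})"
    using assms by (intro closedin_Inter) auto
  moreover have "(\<Inter>g\<in>carrier G. {\<pi> \<in> topspace (Rep_topology G). norm (\<pi> g y - y) \<in> {\<psi> g - c..\<psi> g + c}}) =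
      {\<pi> \<in> Rep G. \<forall>g\<in>carrier G. \<bar>norm (\<pi> g y - y) - \<psi> g\<bar> \<le> c}"
    using assms by (auto simp: abs_le_iff) (force simp: algebra_simps)+
  ultimately show ?thesis by simp
qed

text \<open>
  Inside any open set there are two representations whose displacements of \<open>y\<close> at one \<open>h\<close> differ by
  almost \<open>norm y\<close>, more than the width \<open>2 * c\<close> of the band around \<open>\<psi> h\<close>.
\<close>

lemma nowhere_dense_displacement_near:
  fixes y :: "'g::banach"
  assumes Gur: "gurarij_space TYPE('g)" and "group G" "countable (carrier G)" "infinite (carrier G)"
    and c: "2 * c < norm y"
    and S: "S \<subseteq> {\<pi> \<in> Rep G. \<forall>g\<in>carrier G. \<bar>norm (\<pi> g y - y) - \<psi> g\<bar> \<le> c}"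
  shows "nowhere_dense_in (Rep_topology G) S"
proof -
  interpret group G by fact
  let ?A = "{\<pi> \<in> Rep G. \<forall>g\<in>carrier G. \<bar>norm (\<pi> g y - y) - \<psi> g\<bar> \<le> c}"
  have "(Rep_topology G) interior_of ?A = {}"
  proof (rule ccontr)
    assume "(Rep_topology G) interior_of ?A \<noteq> {}"
    then obtain \<pi> U where U: "openin (Rep_topology G) U" "\<pi> \<in> U" "U \<subseteq> ?A"
      by (auto simp: interior_of_def)
    obtain F X \<delta> where F: "finite F" "F \<subseteq> carrier G" "finite X" "0 < \<delta>"
      and nbhd: "\<forall>\<rho>\<in>Rep G. (\<forall>f\<in>F. \<forall>x\<in>X. norm (\<rho> f x - \<pi> f x) < \<delta>) \<longrightarrow> \<rho> \<in> U"
      by (rule Rep_topology_neighbourhood[OF U(1,2)])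
    define \<epsilon> where "\<epsilon> = min (\<delta> / 2) ((norm y - 2 * c) / 4)"
    have \<epsilon>: "0 < \<epsilon>" "\<epsilon> < \<delta>" "2 * \<epsilon> < norm y - 2 * c" using F(4) c by (auto simp: \<epsilon>_def min_def)
    have \<pi>: "\<pi> \<in> Rep G" using U by blast
    obtain h \<rho> \<sigma> where h: "h \<in> carrier G" and \<rho>\<sigma>: "\<rho> \<in> Rep G" "\<sigma> \<in> Rep G"
      "\<forall>f\<in>F. \<forall>x\<in>X. norm (\<rho> f x - \<pi> f x) \<le> \<epsilon>" "\<forall>f\<in>F. \<forall>x\<in>X. norm (\<sigma> f x - \<pi> f x) \<le> \<epsilon>"
      and disp: "2 * norm y - \<epsilon> \<le> norm (\<rho> h y - y)" "norm (\<sigma> h y - y) \<le> norm y + \<epsilon>"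
      by (rule Rep_near_with_displacements[OF Gur assms(3,4) \<pi> F(1-3) \<epsilon>(1)])
    have "\<rho> \<in> U" by (rule nbhd[rule_format, OF \<rho>\<sigma>(1)]) (use \<rho>\<sigma>(3) \<epsilon>(2) in force)
    moreover have "\<sigma> \<in> U" by (rule nbhd[rule_format, OF \<rho>\<sigma>(2)]) (use \<rho>\<sigma>(4) \<epsilon>(2) in force)
    ultimately have "\<rho> \<in> ?A" "\<sigma> \<in> ?A" using U(3) by blast+
    then have "\<bar>norm (\<rho> h y - y) - \<psi> h\<bar> \<le> c" "\<bar>norm (\<sigma> h y - y) - \<psi> h\<bar> \<le> c" using h by auto
    then show False using disp \<epsilon>(3) by linarith
  qed
  moreover have "(Rep_topology G) closure_of S \<subseteq> ?A"
    using S by (rule closure_of_minimal) (rule closedin_displacement_near, blast)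
  then have "(Rep_topology G) interior_of ((Rep_topology G) closure_of S) \<subseteq> (Rep_topology G) interior_of ?A"
    by (rule interior_of_mono)
  ultimately show ?thesis using S by (auto simp: nowhere_dense_in_def)
qed

lemma gurarij_space_nontrivial:
  assumes "gurarij_space TYPE('g::banach)"
  obtains x :: "'g::banach" where "x \<noteq> 0"
proof -
  let ?e = "unit_vec (0::nat)"
  have 1: "norm_on (span {?e}) norm" by (simp add: norm_on_def norm_triangle_ineq)
  have 2: "linear_map_on {0 :: nat \<Rightarrow>\<^sub>0 real} (\<lambda>_. 0 :: 'g)" by (simp add: linear_map_on_def)
  obtain f :: "(nat \<Rightarrow>\<^sub>0 real) \<Rightarrow> 'g" where "\<And>x. x \<in> span {?e} \<Longrightarrow> inverse (1 + 1) * norm x \<le> norm (f x)"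
    by (rule gurarij_extension[OF assms _ 1 _ _ 2, of 1]) (auto simp: span_zero)
  from this[of ?e] have "f ?e \<noteq> 0" by (auto simp: span_base)
  then show ?thesis by (rule that)
qed

lemma conj_action_apply:
  fixes g :: "'g::real_normed_vector \<Rightarrow> 'g"
  assumes "g \<in> carrier LIso" "\<pi> \<in> Rep G" "\<gamma> \<in> carrier G"
  shows "conj_action G g \<pi> \<gamma> (g x) = g (\<pi> \<gamma> x)"
proof -
  interpret L: group "LIso :: ('g \<Rightarrow> 'g) monoid" by (rule group_LIso)
  have mult: "(S \<otimes>\<^bsub>LIso\<^esub> T) z = S (T z)" and one: "\<one>\<^bsub>LIso\<^esub> z = z" for S T :: "'g \<Rightarrow> 'g" and z
    by (simp_all add: LIso_def)
  have "(inv\<^bsub>LIso\<^esub> g \<otimes>\<^bsub>LIso\<^esub> g) x = x" by (simp only: L.l_inv[OF assms(1)] one)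
  then have "(inv\<^bsub>LIso\<^esub> g) (g x) = x" by (simp only: mult)
  then show ?thesis using assms by (simp add: conj_action_def mult)
qed

theorem theorem3p8:
  fixes \<Gamma> :: "('a, 'b) monoid_scheme"
    and C :: "('a \<Rightarrow> 'g::banach \<Rightarrow> 'g) set"
  assumes "gurarij_space TYPE('g)"
    and "group \<Gamma>"
    and "countable (carrier \<Gamma>)"
    and "infinite (carrier \<Gamma>)"
    and "C \<in> conjugacy_classes \<Gamma>"
  shows "meager_in (Rep_topology \<Gamma>) C"
proof -
  obtain \<pi> where \<pi>: "\<pi> \<in> Rep \<Gamma>" and C: "C = {conj_action \<Gamma> g \<pi> | g. g \<in> carrier LIso}"
    using assms(5) by (auto simp: conjugacy_classes_def orbits_def orbit_def)
  obtain x :: 'g where x: "x \<noteq> 0" using gurarij_space_nontrivial[OF assms(1)] .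
  \<comment> \<open>If \<open>y\<close> is within \<open>r\<close> of a vector of norm \<open>8 * r\<close>, the displacements
    of the two differ by at most \<open>2 * r\<close>, and \<open>2 * (2 * r) < 7 * r \<le> norm y\<close>.\<close>
  define r where "r = norm x / 8"
  have r: "0 < r" "norm x = 8 * r" using x by (auto simp: r_def)
  define \<psi> where "\<psi> = (\<lambda>\<gamma>. norm (\<pi> \<gamma> x - x))"
  define A where "A = (\<lambda>y :: 'g. {\<rho> \<in> Rep \<Gamma>. \<forall>\<gamma>\<in>carrier \<Gamma>. \<bar>norm (\<rho> \<gamma> y - y) - \<psi> \<gamma>\<bar> \<le> 2 * r})"
  obtain D :: "'g set" where D: "countable D" "closure D = UNIV"
    using assms(1) by (auto simp: gurarij_space_def separable_space_def euclidean_closure_of)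
  let ?D = "{y \<in> D. 4 * r < norm y}"
  have cover: "\<exists>y\<in>?D. \<rho> \<in> A y" if \<rho>_C: "\<rho> \<in> C" for \<rho>
  proof -
    obtain g where g: "g \<in> carrier LIso" and \<rho>: "\<rho> = conj_action \<Gamma> g \<pi>" using \<rho>_C C by blast
    have g_lin: "linear g" "\<And>z. norm (g z) = norm z" using g by (auto simp: LIso_def)
    interpret action: group_action LIso "Rep \<Gamma>" "conj_action \<Gamma> :: ('g \<Rightarrow> 'g) \<Rightarrow> _"
      by (rule conj_action_group_action[OF assms(2)])
    have \<rho>_Rep: "\<rho> \<in> Rep \<Gamma>" unfolding \<rho> using g \<pi> by (rule action.element_image) simp
    obtain y where y: "y \<in> D" "norm (y - g x) < r"
      using D(2) closure_approachable[of "g x" D] r(1) by (auto simp: dist_norm)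
    have "norm (g x) \<le> norm y + norm (y - g x)" by norm
    then have y_large: "4 * r < norm y" using y(2) g_lin(2)[of x] r by simp
    have "\<bar>norm (\<rho> \<gamma> y - y) - \<psi> \<gamma>\<bar> \<le> 2 * r" if \<gamma>: "\<gamma> \<in> carrier \<Gamma>" for \<gamma>
    proof -
      have "\<rho> \<gamma> (g x) - g x = g (\<pi> \<gamma> x - x)"
        by (simp add: \<rho> conj_action_apply[OF g \<pi> \<gamma>] linear_diff g_lin(1))
      then have \<psi>: "\<psi> \<gamma> = norm (\<rho> \<gamma> (g x) - g x)" by (simp add: \<psi>_def g_lin(2))
      have "norm (\<rho> \<gamma> y - \<rho> \<gamma> (g x)) = norm (y - g x)"
        using Rep_isometry[OF \<rho>_Rep \<gamma>, of "y - g x"] by (simp add: linear_diff Rep_linear[OF \<rho>_Rep \<gamma>])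
      moreover have "norm (\<rho> \<gamma> y - y) - norm (\<rho> \<gamma> (g x) - g x) \<le> norm (\<rho> \<gamma> y - \<rho> \<gamma> (g x)) + norm (y - g x)"
        by norm
      moreover have "norm (\<rho> \<gamma> (g x) - g x) - norm (\<rho> \<gamma> y - y) \<le> norm (\<rho> \<gamma> y - \<rho> \<gamma> (g x)) + norm (y - g x)"
        by norm
      ultimately show ?thesis using y(2) by (simp add: \<psi>)
    qed
    then show ?thesis using y(1) y_large \<rho>_Rep by (auto simp: A_def)
  qed
  show ?thesis
    unfolding meager_in_def
  proof (intro exI[of _ "(\<lambda>y. C \<inter> A y) ` ?D"] conjI ballI)
    show "countable ((\<lambda>y. C \<inter> A y) ` ?D)" using D(1) by simp
    show "C = \<Union>((\<lambda>y. C \<inter> A y) ` ?D)" using cover by auto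
  next
    fix S assume "S \<in> (\<lambda>y. C \<inter> A y) ` ?D"
    then obtain y where y: "2 * (2 * r) < norm y" "S = C \<inter> A y" by auto
    show "nowhere_dense_in (Rep_topology \<Gamma>) S"
      by (rule nowhere_dense_displacement_near[OF assms(1-4) y(1), of _ \<psi>]) (auto simp: y(2) A_def)
  qed
qed

end
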